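(* The functor $L\cdot Q:\mathbf{BCov}_{\circ,i}\to\mathbf{FCov}_i$ is right adjoint to the forgetful functor from $\mathbf{FCov}_i$ (inductively generated formal covers) to $\mathbf{BCov}_{\circ,i}$ (inductively generated $\circ$-basic covers) and, moreover, is surjective on objects. Here $L\cdot Q$ sends a $\circ$-basic cover $(S,\lhd,\circ)$ generated by an axiom-set $(I,C)$, with unit $I_S$, to the formal cover on $S$ inductively generated by the map $\delta(a,b)=a\circ b$ and the axiom-set $(I,C)$ together with the unit axioms $a\lhd a\circ I_S$ and $a\circ I_S\lhd a$ ($a\in S$), and it sends (the class of) a relation to (the class of) the same relation.
   Context: A basic cover $(S,\lhd)$ on a set $S$ is a relation $\lhd$ between elements and subsets of $S$ such that $a\in U$ implies $a\lhd U$, and $a\lhd U$, $U\lhd V$ imply $a\lhd V$, where $U\lhd V$ means $b\lhd V$ for all $b\in U$. Put $\mathcal A U=\{a\in S\mid a\lhd U\}$; $U=_{\mathcal A}V$ means $\mathcal A U=\mathcal A V$. $Sat(\mathcal A)=\{U\subseteq S\mid U=\mathcal A U\}$ has joins $\bigvee^{\mathcal A}_i\mathcal A U_i=\mathcal A(\bigcup_iU_i)$. Elements are identified with singletons; $a\circ b=\{a\}\circ\{b\}$, etc. For a relation $r$ between $S$ and $T$ and $V\subseteq T$, $r^-V=\{a\in S\mid\exists b\in V,\ a\,r\,b\}$. A basic cover map $r:(S,\lhd_S)\to(T,\lhd_T)$ is a relation between $S$ and $T$ such that $b\lhd_TV$ implies $r^-b\lhd_Sr^-V$; two are equal if $r_1^-b=_{\mathcal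 A_S}r_2^-b$ for all $b\in T$; composition is relational composition. An axiom-set $(I,C)$ on $S$: sets $I(a)$ ($a\in S$) and subsets $C(a,i)\subseteq S$ ($i\in I(a)$), representing the axioms $a\lhd C(a,i)$. It generates the least basic cover with $a\lhd C(a,i)$ for all $a,i$ (inductively defined by: $a\in U$ implies $a\lhd U$; $i\in I(a)$ and $C(a,i)\lhd U$ imply $a\lhd U$). An axiom $U\lhd V$ with a subset $U$ on the left stands for the axioms $x\lhd V$, $x\in U$. A $\circ$-basic cover $(S,\lhd,\circ)$ is a basic cover with a binary operation $\circ$ on $\mathcal P(S)$ which, modulo $=_{\mathcal A}$, distributes over unions ($\bigcup_i(U_i\circ V)=_{\mathcal A}(\bigcup_iU_i)\circ V$), is associative, commutative ($U\circ V=_{\mathcal A}V\circ U$) and has a unit, i.e. a subset $I_S\subseteq S$ with $a=_{\mathcal A}a\circ I_S$ for all $a\in S$. A $\circ$-basic cover map $\mathcal S\to\mathcal T$ is a basic cover map $r$ with $r^-(U\circ_TV)=_{\mathcal A_S}(r^-U)\circ_S(r^-V)$ for all $U,V\subseteq T$ and $r^-I_T=_{\mathcal A_S}I_S$. $\mathbf{BCov}_{\circ,i}$ is the category of $\circ$-basic covers whose underlying basic cover is generated by some axiom-set, with $\circ$-basic cover maps. A convergent cover is $(S,\lhd,\circ)$ where $\lhd$ is a basic cover on $S$ and $\circ$ is a binary operation on $\mathcal P(S)$ such that: $U_1\lhd V_1$ and $U_2\lhd V_2$ imply $U_1\circ U_2\lhd V_1\circ V_2$; $(U\circ V)\circ W\lhd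 U\circ(V\circ W)$; $U\circ V\lhd V\circ U$; and the operation $\mathcal A U\circ^{\mathcal A}\mathcal A V=\mathcal A(U\circ V)$ on $Sat(\mathcal A)$ distributes over arbitrary joins. A formal cover is a convergent cover with $\mathcal A(U\circ V)=\mathcal A U\cap\mathcal A V$ for all $U,V\subseteq S$; then $S$ is a unit. A formal cover map $r:\mathcal S\to\mathcal T$ is a basic cover map with $r^-(b_1\circ_Tb_2)=_{\mathcal A_S}(r^-b_1)\circ_S(r^-b_2)$ for all $b_1,b_2\in T$ and $r^-T=_{\mathcal A_S}S$. In all these categories equality of morphisms is equality of basic cover maps. Inductive generation of formal covers: given an axiom-set $(I,C)$ on a set $S$ and a map $\delta:S\times S\to\mathcal P(S)$, put $U\circ V=\bigcup\{\delta(a,b)\mid a\in U,b\in V\}$. Let $(J,D)$ be $(I,C)$ plus the axioms $a\lhd c\circ b$ for $a\in b\circ c$ and $a\lhd b\circ(c\circ d)$ for $a\in(b\circ c)\circ d$; let $(J',D')$ be $(J,D)$ plus the axioms $a\lhd D(b,j)\circ c$ for $a\in b\circ c$, $j\in J(b)$; let $(J'',D'')$ be $(J',D')$ plus the axioms $a\lhd\{c\}$ for $a\in b\circ c$ and $a\lhd a\circ a$. The formal cover inductively generated by $(I,C)$ and $\delta$ is $(S,\lhd,\circ)$ with $\lhd$ the basic cover generated by $(J'',D'')$. $\mathbf{FCov}_i$ is the category of formal covers of this form, with formal cover maps. *)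

theory Defs
  imports Main
begin

section \<open>Categories, functors, adjunctions\<close>

text \<open>Composition carries the three objects involved as arguments, so hom-sets need not be disjoint.
  \<^term>\<open>Cmp C x y z g f\<close> is the composite of \<open>f : x \<rightarrow> y\<close> followed by \<open>g : y \<rightarrow> z\<close>.\<close>

record ('o, 'm) cat =
  Obj :: "'o set"
  Hom :: "'o \<Rightarrow> 'o \<Rightarrow> 'm set"
  Idt :: "'o \<Rightarrow> 'm"
  Cmp :: "'o \<Rightarrow> 'o \<Rightarrow> 'o \<Rightarrow> 'm \<Rightarrow> 'm \<Rightarrow> 'm"

definition category :: "('o, 'm) cat \<Rightarrow> bool" where
  "category C \<longleftrightarrow>
     (\<forall>x\<in>Obj C. Idt C x \<in> Hom C x x) \<and>
     (\<forall>x\<in>Obj C. \<forall>y\<in>Obj C. \<forall>z\<in>Obj C. \<forall>f\<in>Hom C x y. \<forall>g\<in>Hom C y z.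
        Cmp C x y z g f \<in> Hom C x z) \<and>
     (\<forall>x\<in>Obj C. \<forall>y\<in>Obj C. \<forall>f\<in>Hom C x y.
        Cmp C x x y f (Idt C x) = f \<and> Cmp C x y y (Idt C y) f = f) \<and>
     (\<forall>w\<in>Obj C. \<forall>x\<in>Obj C. \<forall>y\<in>Obj C. \<forall>z\<in>Obj C.
        \<forall>f\<in>Hom C w x. \<forall>g\<in>Hom C x y. \<forall>h\<in>Hom C y z.
        Cmp C w y z h (Cmp C w x y g f) = Cmp C w x z (Cmp C x y z h g) f)"

record ('o, 'm, 'p, 'n) functr =
  on_obj :: "'o \<Rightarrow> 'p"
  on_mor :: "'o \<Rightarrow> 'o \<Rightarrow> 'm \<Rightarrow> 'n"

definition is_functor ::
  "('o, 'm) cat \<Rightarrow> ('p, 'n) cat \<Rightarrow> ('o, 'm, 'p, 'n) functr \<Rightarrow> bool" where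
  "is_functor C D F \<longleftrightarrow> category C \<and> category D \<and>
     (\<forall>x\<in>Obj C. on_obj F x \<in> Obj D) \<and>
     (\<forall>x\<in>Obj C. \<forall>y\<in>Obj C. \<forall>f\<in>Hom C x y.
        on_mor F x y f \<in> Hom D (on_obj F x) (on_obj F y)) \<and>
     (\<forall>x\<in>Obj C. on_mor F x x (Idt C x) = Idt D (on_obj F x)) \<and>
     (\<forall>x\<in>Obj C. \<forall>y\<in>Obj C. \<forall>z\<in>Obj C. \<forall>f\<in>Hom C x y. \<forall>g\<in>Hom C y z.
        on_mor F x z (Cmp C x y z g f) =
        Cmp D (on_obj F x) (on_obj F y) (on_obj F z) (on_mor F y z g) (on_mor F x y f))"

text \<open>\<open>F : C \<rightarrow> D\<close> is the left and \<open>G : D \<rightarrow> C\<close> the right adjoint.\<close>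

definition adjunction ::
  "('o, 'm) cat \<Rightarrow> ('p, 'n) cat \<Rightarrow> ('o, 'm, 'p, 'n) functr \<Rightarrow> ('p, 'n, 'o, 'm) functr \<Rightarrow> bool"
where
  "adjunction C D F G \<longleftrightarrow> is_functor C D F \<and> is_functor D C G \<and>
     (\<exists>\<phi>. (\<forall>x\<in>Obj C. \<forall>y\<in>Obj D.
            bij_betw (\<phi> x y) (Hom D (on_obj F x) y) (Hom C x (on_obj G y))) \<and>
          (\<forall>x\<in>Obj C. \<forall>x'\<in>Obj C. \<forall>y\<in>Obj D. \<forall>y'\<in>Obj D.
            \<forall>h\<in>Hom C x' x. \<forall>k\<in>Hom D y y'. \<forall>f\<in>Hom D (on_obj F x) y.
            \<phi> x' y' (Cmp D (on_obj F x') y y' k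
                       (Cmp D (on_obj F x') (on_obj F x) y f (on_mor F x' x h))) =
            Cmp C x' (on_obj G y) (on_obj G y') (on_mor G y y' k)
                       (Cmp C x' x (on_obj G y) (\<phi> x y f) h)))"


section \<open>Basic covers with an operation\<close>

text \<open>The carrier is a subset of an arbitrary type, which plays the role of the universe of sets.
  So that equality of records is equality of structures, the cover relates only elements to subsets
  of the carrier, and the operation is \<open>{}\<close> when an argument is not a subset of the carrier
  (see \<open>op_cover\<close> below).\<close>

record 'a cover =
  carrier :: "'a set"
  cov :: "('a \<times> 'a set) set"
  circ :: "'a set \<Rightarrow> 'a set \<Rightarrow> 'a set"

definition basic_cover :: "'a set \<Rightarrow> ('a \<times> 'a set) set \<Rightarrow> bool" where
  "basic_cover S R \<longleftrightarrow> R \<subseteq> S \<times> Pow S \<and>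
     (\<forall>U\<subseteq>S. \<forall>a\<in>U. (a, U) \<in> R) \<and>
     (\<forall>a U V. (a, U) \<in> R \<longrightarrow> V \<subseteq> S \<longrightarrow> (\<forall>b\<in>U. (b, V) \<in> R) \<longrightarrow> (a, V) \<in> R)"

definition covers :: "'a cover \<Rightarrow> 'a set \<Rightarrow> 'a set \<Rightarrow> bool" where
  "covers X U V \<longleftrightarrow> (\<forall>a\<in>U. (a, V) \<in> cov X)"

definition sat :: "'a cover \<Rightarrow> 'a set \<Rightarrow> 'a set" where
  "sat X U = {a \<in> carrier X. (a, U) \<in> cov X}"

definition Sat :: "'a cover \<Rightarrow> 'a set set" where
  "Sat X = {U. U \<subseteq> carrier X \<and> U = sat X U}"

definition eqA :: "'a cover \<Rightarrow> 'a set \<Rightarrow> 'a set \<Rightarrow> bool" where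
  "eqA X U V \<longleftrightarrow> sat X U = sat X V"

definition op_cover :: "'a cover \<Rightarrow> bool" where
  "op_cover X \<longleftrightarrow> basic_cover (carrier X) (cov X) \<and>
     (\<forall>U V. U \<subseteq> carrier X \<and> V \<subseteq> carrier X \<longrightarrow> circ X U V \<subseteq> carrier X) \<and>
     (\<forall>U V. \<not> (U \<subseteq> carrier X \<and> V \<subseteq> carrier X) \<longrightarrow> circ X U V = {})"

definition is_unit :: "'a cover \<Rightarrow> 'a set \<Rightarrow> bool" where
  "is_unit X E \<longleftrightarrow> E \<subseteq> carrier X \<and> (\<forall>a\<in>carrier X. eqA X {a} (circ X {a} E))"

text \<open>The operation of a \<open>\<circ>\<close>-basic cover is not required to respect \<open>eqA\<close>.\<close>

definition circ_cover :: "'a cover \<Rightarrow> bool" where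
  "circ_cover X \<longleftrightarrow> op_cover X \<and>
     (\<forall>\<U>\<subseteq>Pow (carrier X). \<forall>V\<subseteq>carrier X.
        eqA X (\<Union>U\<in>\<U>. circ X U V) (circ X (\<Union>\<U>) V)) \<and>
     (\<forall>U\<subseteq>carrier X. \<forall>V\<subseteq>carrier X. \<forall>W\<subseteq>carrier X.
        eqA X (circ X (circ X U V) W) (circ X U (circ X V W))) \<and>
     (\<forall>U\<subseteq>carrier X. \<forall>V\<subseteq>carrier X. eqA X (circ X U V) (circ X V U)) \<and>
     (\<exists>E. is_unit X E)"

definition convergent_cover :: "'a cover \<Rightarrow> bool" where
  "convergent_cover X \<longleftrightarrow> op_cover X \<and>
     (\<forall>U1\<subseteq>carrier X. \<forall>V1\<subseteq>carrier X. \<forall>U2\<subseteq>carrier X. \<forall>V2\<subseteq>carrier X.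
        covers X U1 V1 \<longrightarrow> covers X U2 V2 \<longrightarrow> covers X (circ X U1 U2) (circ X V1 V2)) \<and>
     (\<forall>U\<subseteq>carrier X. \<forall>V\<subseteq>carrier X. \<forall>W\<subseteq>carrier X.
        covers X (circ X (circ X U V) W) (circ X U (circ X V W))) \<and>
     (\<forall>U\<subseteq>carrier X. \<forall>V\<subseteq>carrier X. covers X (circ X U V) (circ X V U)) \<and>
     (\<forall>U\<in>Sat X. \<forall>\<V>\<subseteq>Sat X.
        sat X (circ X U (sat X (\<Union>\<V>))) = sat X (\<Union>V\<in>\<V>. sat X (circ X U V)))"

definition formal_cover :: "'a cover \<Rightarrow> bool" where
  "formal_cover X \<longleftrightarrow> convergent_cover X \<and>
     (\<forall>U\<subseteq>carrier X. \<forall>V\<subseteq>carrier X. sat X (circ X U V) = sat X U \<inter> sat X V)"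


section \<open>Inductive generation\<close>

text \<open>An axiom-set \<open>(I, C)\<close> is represented by \<open>\<lambda>a. {C(a,i) | i \<in> I(a)}\<close>: the generated cover
  depends on the family \<open>C(a,_)\<close> only through its image, and this avoids an index type.\<close>

type_synonym 'a axioms = "'a \<Rightarrow> 'a set set"

definition axiom_set :: "'a set \<Rightarrow> 'a axioms \<Rightarrow> bool" where
  "axiom_set S ax \<longleftrightarrow> (\<forall>a\<in>S. ax a \<subseteq> Pow S)"

inductive_set gen_cov :: "'a set \<Rightarrow> 'a axioms \<Rightarrow> ('a \<times> 'a set) set"
  for S :: "'a set" and ax :: "'a axioms" where
  refl: "U \<subseteq> S \<Longrightarrow> a \<in> U \<Longrightarrow> (a, U) \<in> gen_cov S ax"
| infer: "a \<in> S \<Longrightarrow> U \<subseteq> S \<Longrightarrow> D \<in> ax a \<Longrightarrow> (\<And>x. x \<in> D \<Longrightarrow> (x, U) \<in> gen_cov S ax)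
          \<Longrightarrow> (a, U) \<in> gen_cov S ax"

definition lift_op :: "'a set \<Rightarrow> ('a \<Rightarrow> 'a \<Rightarrow> 'a set) \<Rightarrow> 'a set \<Rightarrow> 'a set \<Rightarrow> 'a set" where
  "lift_op S \<delta> U V = (if U \<subseteq> S \<and> V \<subseteq> S then \<Union>a\<in>U. \<Union>b\<in>V. \<delta> a b else {})"

definition ax_J :: "'a set \<Rightarrow> ('a set \<Rightarrow> 'a set \<Rightarrow> 'a set) \<Rightarrow> 'a axioms \<Rightarrow> 'a axioms" where
  "ax_J S m ax a = ax a
     \<union> {m {c} {b} | b c. b \<in> S \<and> c \<in> S \<and> a \<in> m {b} {c}}
     \<union> {m {b} (m {c} {d}) | b c d. b \<in> S \<and> c \<in> S \<and> d \<in> S \<and> a \<in> m (m {b} {c}) {d}}"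

definition ax_J' :: "'a set \<Rightarrow> ('a set \<Rightarrow> 'a set \<Rightarrow> 'a set) \<Rightarrow> 'a axioms \<Rightarrow> 'a axioms" where
  "ax_J' S m ax a = ax_J S m ax a
     \<union> {m D {c} | b c D. b \<in> S \<and> c \<in> S \<and> a \<in> m {b} {c} \<and> D \<in> ax_J S m ax b}"

definition ax_J'' :: "'a set \<Rightarrow> ('a set \<Rightarrow> 'a set \<Rightarrow> 'a set) \<Rightarrow> 'a axioms \<Rightarrow> 'a axioms" where
  "ax_J'' S m ax a = ax_J' S m ax a
     \<union> {{c} | b c. b \<in> S \<and> c \<in> S \<and> a \<in> m {b} {c}}
     \<union> {m {a} {a}}"

definition gen_formal_cover :: "'a set \<Rightarrow> 'a axioms \<Rightarrow> ('a \<Rightarrow> 'a \<Rightarrow> 'a set) \<Rightarrow> 'a cover" where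
  "gen_formal_cover S ax \<delta> =
     \<lparr>carrier = S, cov = gen_cov S (ax_J'' S (lift_op S \<delta>) ax), circ = lift_op S \<delta>\<rparr>"


section \<open>Morphisms\<close>

text \<open>For \<open>r \<subseteq> S \<times> T\<close>, the inverse image of \<open>V\<close> is the image of \<open>V\<close> under the converse.\<close>

definition preim :: "('a \<times> 'a) set \<Rightarrow> 'a set \<Rightarrow> 'a set" where
  "preim r V = r\<inverse> `` V"

definition basic_map :: "'a cover \<Rightarrow> 'a cover \<Rightarrow> ('a \<times> 'a) set \<Rightarrow> bool" where
  "basic_map X Y r \<longleftrightarrow> r \<subseteq> carrier X \<times> carrier Y \<and>
     (\<forall>b V. (b, V) \<in> cov Y \<longrightarrow> covers X (preim r {b}) (preim r V))"

text \<open>Units exist and are unique up to \<open>eqA\<close>, so the choice of units is immaterial.\<close>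

definition circ_map :: "'a cover \<Rightarrow> 'a cover \<Rightarrow> ('a \<times> 'a) set \<Rightarrow> bool" where
  "circ_map X Y r \<longleftrightarrow> basic_map X Y r \<and>
     (\<forall>U\<subseteq>carrier Y. \<forall>V\<subseteq>carrier Y.
        eqA X (preim r (circ Y U V)) (circ X (preim r U) (preim r V))) \<and>
     (\<forall>E F. is_unit X E \<longrightarrow> is_unit Y F \<longrightarrow> eqA X (preim r F) E)"

definition formal_map :: "'a cover \<Rightarrow> 'a cover \<Rightarrow> ('a \<times> 'a) set \<Rightarrow> bool" where
  "formal_map X Y r \<longleftrightarrow> basic_map X Y r \<and>
     (\<forall>b1\<in>carrier Y. \<forall>b2\<in>carrier Y.
        eqA X (preim r (circ Y {b1} {b2})) (circ X (preim r {b1}) (preim r {b2}))) \<and>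
     eqA X (preim r (carrier Y)) (carrier X)"


section \<open>The two categories\<close>

text \<open>A morphism is a class of relations, with respect to equality of basic cover maps, within the
  maps \<open>M X Y\<close> of the category at hand.\<close>

type_synonym 'a mor = "('a \<times> 'a) set set"
type_synonym 'a mor_pred = "'a cover \<Rightarrow> 'a cover \<Rightarrow> ('a \<times> 'a) set \<Rightarrow> bool"

definition map_eq :: "'a mor_pred \<Rightarrow> 'a cover \<Rightarrow> 'a cover \<Rightarrow> (('a \<times> 'a) set \<times> ('a \<times> 'a) set) set"
where
  "map_eq M X Y = {(r, s). M X Y r \<and> M X Y s \<and>
     (\<forall>b\<in>carrier Y. eqA X (preim r {b}) (preim s {b}))}"

definition map_class :: "'a mor_pred \<Rightarrow> 'a cover \<Rightarrow> 'a cover \<Rightarrow> ('a \<times> 'a) set \<Rightarrow> 'a mor" where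
  "map_class M X Y r = map_eq M X Y `` {r}"

definition cover_cat :: "'a cover set \<Rightarrow> 'a mor_pred \<Rightarrow> ('a cover, 'a mor) cat" where
  "cover_cat Ob M =
     \<lparr>Obj = Ob,
      Hom = (\<lambda>X Y. {r. M X Y r} // map_eq M X Y),
      Idt = (\<lambda>X. map_class M X X (Id_on (carrier X))),
      Cmp = (\<lambda>X Y Z g f. \<Union>r\<in>f. \<Union>s\<in>g. map_class M X Z (r O s))\<rparr>"

definition BCov :: "('a cover, 'a mor) cat" where
  "BCov = cover_cat
     {X. circ_cover X \<and> (\<exists>ax. axiom_set (carrier X) ax \<and> cov X = gen_cov (carrier X) ax)}
     circ_map"

definition FCov :: "('a cover, 'a mor) cat" where
  "FCov = cover_cat
     {X. formal_cover X \<and>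
         (\<exists>ax \<delta>. axiom_set (carrier X) ax \<and>
            (\<forall>a\<in>carrier X. \<forall>b\<in>carrier X. \<delta> a b \<subseteq> carrier X) \<and>
            X = gen_formal_cover (carrier X) ax \<delta>)}
     formal_map"


section \<open>The functors\<close>

definition Forget :: "('a cover, 'a mor, 'a cover, 'a mor) functr" where
  "Forget = \<lparr>on_obj = (\<lambda>X. X), on_mor = (\<lambda>X Y f. \<Union>r\<in>f. map_class circ_map X Y r)\<rparr>"

definition unit_axioms :: "'a cover \<Rightarrow> 'a set \<Rightarrow> 'a axioms" where
  "unit_axioms X E a = {circ X {a} E} \<union> {{b} | b. b \<in> carrier X \<and> a \<in> circ X {b} E}"

definition LQ_gen :: "'a cover \<Rightarrow> 'a axioms \<Rightarrow> 'a set \<Rightarrow> 'a cover" where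
  "LQ_gen X ax E =
     gen_formal_cover (carrier X) (\<lambda>a. ax a \<union> unit_axioms X E a) (\<lambda>a b. circ X {a} {b})"

text \<open>\<open>presents X ax E\<close>: the cover is generated by \<open>ax\<close> and \<open>E\<close> is a unit. The object part of
  \<open>L \<cdot> Q\<close> takes any such presentation; it has to be shown that the result does not depend on it.\<close>

definition presents :: "'a cover \<Rightarrow> 'a axioms \<Rightarrow> 'a set \<Rightarrow> bool" where
  "presents X ax E \<longleftrightarrow>
     axiom_set (carrier X) ax \<and> cov X = gen_cov (carrier X) ax \<and> is_unit X E"

definition LQ_obj :: "'a cover \<Rightarrow> 'a cover" where
  "LQ_obj X = (SOME Y. \<exists>ax E. presents X ax E \<and> Y = LQ_gen X ax E)"

definition LQ :: "('a cover, 'a mor, 'a cover, 'a mor) functr" where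
  "LQ = \<lparr>on_obj = LQ_obj,
         on_mor = (\<lambda>X Y f. \<Union>r\<in>f. map_class formal_map (LQ_obj X) (LQ_obj Y) r)\<rparr>"

end

theory Submission
  imports Defs
begin

text \<open>Call an operation \<open>\<circ>\<close> a meet for a basic cover if \<open>a \<lhd> U \<circ> V\<close> holds exactly when both
  \<open>a \<lhd> U\<close> and \<open>a \<lhd> V\<close> hold. The point of the proof is that the formal cover generated by an
  axiom-set and a map \<open>\<delta>\<close> has the \<^emph>\<open>least\<close> basic cover that satisfies the axioms and for which
  the operation given by \<open>\<delta>\<close> is a meet. One half (\<open>gen_formal_cover_least\<close>) is immediate: every
  axiom added in the construction holds as soon as the operation is a meet. The other half
  (\<open>meet_op_gen_formal_cover\<close>) says that the construction adds enough axioms: weakening and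
  contraction give a meet once \<open>\<lhd>\<close> is stable under \<open>\<circ>\<close>, and stability is proved by
  induction on derivations. Localised copies are added for the axioms in \<open>J\<close> only; for the
  localisation axioms themselves, weakening and contraction, stability is a calculation with
  commutativity and associativity.

  In a \<open>\<circ>\<close>-basic cover, \<open>U \<circ> V\<close> is equal modulo \<open>=\<^sub>A\<close> to the union of the \<open>a \<circ> b\<close> with
  \<open>a \<in> U\<close> and \<open>b \<in> V\<close>, and the unit axioms hold already. So \<open>L \<cdot> Q\<close> sends \<open>X\<close> to the least
  cover that contains that of \<open>X\<close> and for which this pointwise operation is a meet
  (\<open>LQ_gen_least\<close>). Everything follows from this description. It does not mention a presentation,
  so the result does not depend on one. A formal cover is its own least such cover, so \<open>L \<cdot> Q\<close> fixes
  every object of \<open>FCov\<close> and is surjective on objects. If \<open>r\<close> is a map \<open>X \<rightarrow> Y\<close>, the relation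
  \<open>r\<^sup>- b \<lhd> r\<^sup>- V\<close> in \<open>L \<cdot> Q\<close> of \<open>X\<close> is a basic cover on the carrier of \<open>Y\<close>, it contains the cover
  of \<open>Y\<close>, and the operation of \<open>Y\<close> is a meet for it; by minimality it contains the cover of
  \<open>L \<cdot> Q\<close> of \<open>Y\<close>, which means that \<open>r\<close> is a basic cover map between the images.

  Conversely, for a formal cover \<open>X\<close>, a formal cover map from \<open>X\<close> to \<open>L \<cdot> Q\<close> of \<open>Y\<close> is a map from
  \<open>X\<close> to \<open>Y\<close>, because the cover of \<open>Y\<close> is the smaller one. So the relations that represent
  morphisms \<open>X \<rightarrow> Y\<close> and \<open>X \<rightarrow> L \<cdot> Q Y\<close> are the same (\<open>formal_map_LQ_obj_iff\<close>), and so is their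
  equality, which depends on the cover of \<open>X\<close> and the carrier of \<open>Y\<close> only. Thus \<open>FCov\<close> is a full
  coreflective subcategory of \<open>BCov\<close>, and the bijection of the adjunction is the action of \<open>L \<cdot> Q\<close>
  on morphisms, which makes naturality a case of functoriality.\<close>


section \<open>Basic covers\<close>

lemma basic_cover_carrier:
  assumes "basic_cover S R" "(a, U) \<in> R"
  shows "a \<in> S" "U \<subseteq> S"
proof -
  have "R \<subseteq> S \<times> Pow S"
    using assms(1) unfolding basic_cover_def by simp
  then show "a \<in> S" "U \<subseteq> S"
    using assms(2) by auto
qed

lemma basic_cover_refl: "basic_cover S R \<Longrightarrow> U \<subseteq> S \<Longrightarrow> a \<in> U \<Longrightarrow> (a, U) \<in> R"
  unfolding basic_cover_def by simp

lemma basic_cover_trans: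
  assumes "basic_cover S R" "(a, U) \<in> R" "V \<subseteq> S" "\<And>b. b \<in> U \<Longrightarrow> (b, V) \<in> R"
  shows "(a, V) \<in> R"
proof -
  have "\<forall>a U V. (a, U) \<in> R \<longrightarrow> V \<subseteq> S \<longrightarrow> (\<forall>b\<in>U. (b, V) \<in> R) \<longrightarrow> (a, V) \<in> R"
    using assms(1) unfolding basic_cover_def by simp
  then show ?thesis
    using assms(2-4) by blast
qed

lemma gen_cov_carrier: "(a, U) \<in> gen_cov S ax \<Longrightarrow> a \<in> S \<and> U \<subseteq> S"
  by (induction rule: gen_cov.induct) auto

lemma basic_cover_gen_cov: "basic_cover S (gen_cov S ax)"
proof -
  have "(a, V) \<in> gen_cov S ax"
    if "(a, U) \<in> gen_cov S ax" "V \<subseteq> S" "\<forall>b\<in>U. (b, V) \<in> gen_cov S ax" for a U V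
    using that
  proof (induction rule: gen_cov.induct)
    case (refl U a)
    then show ?case by blast
  next
    case (infer a U D)
    show ?case
      by (rule gen_cov.infer[of a S V D]) (use infer in auto)
  qed
  then show ?thesis
    unfolding basic_cover_def
  proof (intro conjI)
    show "gen_cov S ax \<subseteq> S \<times> Pow S"
      using gen_cov_carrier by fast
  qed (simp_all add: gen_cov.refl)
qed

lemma gen_cov_axiom: "a \<in> S \<Longrightarrow> D \<in> ax a \<Longrightarrow> D \<subseteq> S \<Longrightarrow> (a, D) \<in> gen_cov S ax"
  by (rule gen_cov.infer[of a S D D]) (auto intro: gen_cov.refl)

lemma gen_cov_least:
  assumes R: "basic_cover S R" and ax: "\<And>a D. a \<in> S \<Longrightarrow> D \<in> ax a \<Longrightarrow> (a, D) \<in> R"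
  shows "gen_cov S ax \<subseteq> R"
proof -
  have "(a, U) \<in> R" if "(a, U) \<in> gen_cov S ax" for a U
    using that
  proof (induction rule: gen_cov.induct)
    case (refl U a)
    then show ?case by (rule basic_cover_refl[OF R])
  next
    case (infer a U D)
    show ?case
      by (rule basic_cover_trans[OF R ax]) (use infer in auto)
  qed
  then show ?thesis by auto
qed

lemma gen_cov_mono:
  assumes "\<And>a. a \<in> S \<Longrightarrow> ax a \<subseteq> ax' a"
  shows "gen_cov S ax \<subseteq> gen_cov S ax'"
proof -
  have "(a, U) \<in> gen_cov S ax'" if "(a, U) \<in> gen_cov S ax" for a U
    using that
  proof (induction rule: gen_cov.induct)
    case (refl U a)
    then show ?case by (rule gen_cov.refl)
  next
    case (infer a U D)
    show ?case
      by (rule gen_cov.infer[of a S U D]) (use infer assms in blast)+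
  qed
  then show ?thesis by auto
qed


subsection \<open>Saturation\<close>

abbreviation is_cover :: "'a cover \<Rightarrow> bool" where
  "is_cover X \<equiv> basic_cover (carrier X) (cov X)"

lemma sat_subset: "sat X U \<subseteq> carrier X"
  unfolding sat_def by auto

lemma subset_sat: "is_cover X \<Longrightarrow> U \<subseteq> carrier X \<Longrightarrow> U \<subseteq> sat X U"
  unfolding sat_def using basic_cover_refl by fastforce

lemma sat_subset_iff:
  assumes "is_cover X" "U \<subseteq> carrier X" "V \<subseteq> carrier X"
  shows "sat X U \<subseteq> sat X V \<longleftrightarrow> U \<subseteq> sat X V"
proof
  show "U \<subseteq> sat X V" if "sat X U \<subseteq> sat X V"
    using subset_sat[OF assms(1,2)] that by blast
  show "sat X U \<subseteq> sat X V" if "U \<subseteq> sat X V"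
    using that basic_cover_trans[OF assms(1) _ assms(3)] unfolding sat_def by blast
qed

lemma eqA_iff:
  assumes "is_cover X" "U \<subseteq> carrier X" "V \<subseteq> carrier X"
  shows "eqA X U V \<longleftrightarrow> U \<subseteq> sat X V \<and> V \<subseteq> sat X U"
  unfolding eqA_def using sat_subset_iff[OF assms(1,2,3)] sat_subset_iff[OF assms(1,3,2)] by blast

lemma eqA_refl: "eqA X U U"
  and eqA_sym: "eqA X U V \<Longrightarrow> eqA X V U"
  and eqA_trans [trans]: "eqA X U V \<Longrightarrow> eqA X V W \<Longrightarrow> eqA X U W"
  unfolding eqA_def by auto

lemma sat_mono:
  assumes "is_cover X" "U \<subseteq> V" "V \<subseteq> carrier X"
  shows "sat X U \<subseteq> sat X V"
  using assms sat_subset_iff[of X U V] subset_sat[of X V] by blast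

lemma eqA_UN:
  assumes X: "is_cover X"
    and sub: "\<And>i. i \<in> K \<Longrightarrow> A i \<subseteq> carrier X" "\<And>i. i \<in> K \<Longrightarrow> B i \<subseteq> carrier X"
    and eq: "\<And>i. i \<in> K \<Longrightarrow> eqA X (A i) (B i)"
  shows "eqA X (\<Union>i\<in>K. A i) (\<Union>i\<in>K. B i)"
proof -
  have "A i \<subseteq> sat X (\<Union>i\<in>K. B i)" "B i \<subseteq> sat X (\<Union>i\<in>K. A i)" if "i \<in> K" for i
  proof -
    have "A i \<subseteq> sat X (B i)" "B i \<subseteq> sat X (A i)"
      using eq[OF that] eqA_iff[OF X sub(1)[OF that] sub(2)[OF that]] by auto
    moreover have "sat X (B i) \<subseteq> sat X (\<Union>i\<in>K. B i)" "sat X (A i) \<subseteq> sat X (\<Union>i\<in>K. A i)"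
      by (rule sat_mono[OF X], use that sub in blast, use that sub in blast)+
    ultimately show "A i \<subseteq> sat X (\<Union>i\<in>K. B i)" "B i \<subseteq> sat X (\<Union>i\<in>K. A i)" by auto
  qed
  moreover have "(\<Union>i\<in>K. A i) \<subseteq> carrier X" "(\<Union>i\<in>K. B i) \<subseteq> carrier X"
    using sub by blast+
  ultimately show ?thesis
    by (subst eqA_iff[OF X]) auto
qed

lemma eqA_larger_cover:
  assumes X: "is_cover X" and Z: "is_cover Z" "carrier Z = carrier X" "cov X \<subseteq> cov Z"
    and sub: "U \<subseteq> carrier X" "V \<subseteq> carrier X" and eq: "eqA X U V"
  shows "eqA Z U V"
proof -
  have "sat X W \<subseteq> sat Z W" for W
    using Z(2,3) unfolding sat_def by auto
  moreover have "U \<subseteq> sat X V" "V \<subseteq> sat X U"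
    using eq eqA_iff[OF X sub] by simp_all
  ultimately have "U \<subseteq> sat Z V" "V \<subseteq> sat Z U"
    by auto
  then show ?thesis
    using eqA_iff[OF Z(1), of U V] Z(2) sub by simp
qed


subsection \<open>Operations given on elements\<close>

lemma lift_op_iff:
  "U \<subseteq> S \<Longrightarrow> V \<subseteq> S \<Longrightarrow> x \<in> lift_op S \<delta> U V \<longleftrightarrow> (\<exists>a\<in>U. \<exists>b\<in>V. x \<in> \<delta> a b)"
  unfolding lift_op_def by auto

lemma lift_op_singletons: "a \<in> S \<Longrightarrow> b \<in> S \<Longrightarrow> lift_op S \<delta> {a} {b} = \<delta> a b"
  unfolding lift_op_def by auto

lemma lift_op_subset:
  "(\<And>a b. a \<in> S \<Longrightarrow> b \<in> S \<Longrightarrow> \<delta> a b \<subseteq> S) \<Longrightarrow> lift_op S \<delta> U V \<subseteq> S"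
  unfolding lift_op_def by (simp add: subset_iff) blast

lemma lift_op_mono:
  "U \<subseteq> U' \<Longrightarrow> V \<subseteq> V' \<Longrightarrow> U' \<subseteq> S \<Longrightarrow> V' \<subseteq> S \<Longrightarrow> lift_op S \<delta> U V \<subseteq> lift_op S \<delta> U' V'"
  unfolding lift_op_def by auto

text \<open>An operation given by a map on elements is recovered from its values at singletons.\<close>

lemma lift_op_lift_op: "lift_op S (\<lambda>a b. lift_op S \<delta> {a} {b}) = lift_op S \<delta>"
proof (intro ext)
  fix U V
  have "(\<Union>a\<in>U. \<Union>b\<in>V. lift_op S \<delta> {a} {b}) = (\<Union>a\<in>U. \<Union>b\<in>V. \<delta> a b)" if "U \<subseteq> S" "V \<subseteq> S"
    using that by (intro SUP_cong refl lift_op_singletons) auto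
  then show "lift_op S (\<lambda>a b. lift_op S \<delta> {a} {b}) U V = lift_op S \<delta> U V"
    unfolding lift_op_def[of S "\<lambda>a b. lift_op S \<delta> {a} {b}"] lift_op_def[of S \<delta> U V] by simp
qed


section \<open>Formal covers\<close>

text \<open>\<open>meet_op\<close> isolates what distinguishes formal covers in a form that speaks only of a cover
  relation and an operation, so that it can be tested on covers that are not part of a
  \<open>cover\<close> record, such as the inverse image of a cover along a relation.\<close>

definition meet_op :: "'a set \<Rightarrow> ('a \<times> 'a set) set \<Rightarrow> ('a set \<Rightarrow> 'a set \<Rightarrow> 'a set) \<Rightarrow> bool" where
  "meet_op S R m \<longleftrightarrow>
     (\<forall>U\<subseteq>S. \<forall>V\<subseteq>S. m U V \<subseteq> S \<and> (\<forall>a. (a, m U V) \<in> R \<longleftrightarrow> (a, U) \<in> R \<and> (a, V) \<in> R))"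

lemma meet_opD:
  assumes "meet_op S R m" "U \<subseteq> S" "V \<subseteq> S"
  shows "m U V \<subseteq> S" "(a, m U V) \<in> R \<longleftrightarrow> (a, U) \<in> R \<and> (a, V) \<in> R"
  using assms unfolding meet_op_def by blast+

lemma meet_op_lower:
  assumes R: "basic_cover S R" and m: "meet_op S R m" and "U \<subseteq> S" "V \<subseteq> S" "a \<in> m U V"
  shows "(a, U) \<in> R" "(a, V) \<in> R"
  using basic_cover_refl[OF R meet_opD(1)[OF m assms(3,4)] assms(5)]
  by (simp_all add: meet_opD(2)[OF m assms(3,4)])

lemma formal_cover_meet_op:
  assumes "formal_cover X"
  shows "is_cover X" "meet_op (carrier X) (cov X) (circ X)"
proof -
  have "op_cover X"
    using assms unfolding formal_cover_def convergent_cover_def by simp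
  then show X: "is_cover X"
    unfolding op_cover_def by simp
  have closed: "circ X U V \<subseteq> carrier X" if "U \<subseteq> carrier X" "V \<subseteq> carrier X" for U V
    using \<open>op_cover X\<close> that unfolding op_cover_def by simp
  have sat: "sat X (circ X U V) = sat X U \<inter> sat X V" if "U \<subseteq> carrier X" "V \<subseteq> carrier X" for U V
    using assms that unfolding formal_cover_def by simp
  have "a \<in> sat X U \<longleftrightarrow> (a, U) \<in> cov X" for a U
    unfolding sat_def using basic_cover_carrier(1)[OF X] by auto
  then show "meet_op (carrier X) (cov X) (circ X)"
    unfolding meet_op_def using closed sat by (metis IntD1 IntD2 IntI)
qed

text \<open>Where saturation turns the operation into intersection, stability, associativity and
  commutativity are facts about intersections of saturated sets. Distributivity over joins holds because
  an operation given on elements distributes over unions exactly.\<close>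

lemma formal_coverI:
  assumes X: "is_cover X" and m: "meet_op (carrier X) (cov X) (lift_op (carrier X) \<delta>)"
    and circ: "circ X = lift_op (carrier X) \<delta>"
  shows "formal_cover X"
proof -
  have m: "meet_op (carrier X) (cov X) (circ X)"
    using m circ by simp
  note D = meet_opD[OF m]
  have sat_circ: "sat X (circ X U V) = sat X U \<inter> sat X V"
    if "U \<subseteq> carrier X" "V \<subseteq> carrier X" for U V
    using D(2)[OF that] unfolding sat_def by blast
  have covers_iff: "covers X U V \<longleftrightarrow> sat X U \<subseteq> sat X V" if "U \<subseteq> carrier X" "V \<subseteq> carrier X" for U V
    using sat_subset_iff[OF X that] that unfolding covers_def sat_def by blast
  have join: "sat X (circ X U (sat X (\<Union>\<V>))) = sat X (\<Union>V\<in>\<V>. sat X (circ X U V))"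
    if U: "U \<in> Sat X" and V: "\<V> \<subseteq> Sat X" for U \<V>
  proof -
    have sub: "U \<subseteq> carrier X" "\<Union>\<V> \<subseteq> carrier X" and subV: "\<And>V. V \<in> \<V> \<Longrightarrow> V \<subseteq> carrier X"
      using U V unfolding Sat_def by auto
    have "circ X U (\<Union>\<V>) = (\<Union>V\<in>\<V>. circ X U V)"
      unfolding circ lift_op_def using sub subV by auto
    also have "sat X \<dots> = sat X (\<Union>V\<in>\<V>. sat X (circ X U V))"
    proof (fold eqA_def, rule eqA_UN[OF X])
      fix V assume V: "V \<in> \<V>"
      show "circ X U V \<subseteq> carrier X" by (rule D(1)[OF sub(1) subV[OF V]])
      then show "eqA X (circ X U V) (sat X (circ X U V))"
        using eqA_iff[OF X _ sat_subset] subset_sat[OF X] subset_sat[OF X sat_subset] by blast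
    qed (rule sat_subset)
    finally have "sat X (\<Union>V\<in>\<V>. sat X (circ X U V)) = sat X (circ X U (\<Union>\<V>))" ..
    moreover have "sat X (sat X (\<Union>\<V>)) = sat X (\<Union>\<V>)"
      using sat_subset_iff[OF X sat_subset sub(2)] sat_subset_iff[OF X sub(2) sat_subset]
        subset_sat[OF X sub(2)] subset_sat[OF X sat_subset] by blast
    ultimately show ?thesis
      using sat_circ sub sat_subset by metis
  qed
  have "op_cover X"
    unfolding op_cover_def using X D(1) by (auto simp: circ lift_op_def)
  moreover have "covers X (circ X U1 U2) (circ X V1 V2)"
    if "U1 \<subseteq> carrier X" "V1 \<subseteq> carrier X" "U2 \<subseteq> carrier X" "V2 \<subseteq> carrier X"
      "covers X U1 V1" "covers X U2 V2" for U1 U2 V1 V2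
    using that by (auto simp: covers_iff sat_circ D(1))
  ultimately show ?thesis
    unfolding formal_cover_def convergent_cover_def using join
    by (auto simp: covers_iff sat_circ D(1))
qed


section \<open>Inductively generated formal covers\<close>

subsection \<open>Stability of the generated cover\<close>

text \<open>The setting for calculations with a commutative and associative operation. Both laws are assumed
  in one direction and on elements only, as the generating axioms supply them. Stability is not
  assumed, because the laws are used to prove it.\<close>

locale comm_semigroup_cover =
  fixes S :: "'a set" and R :: "('a \<times> 'a set) set" and \<delta> :: "'a \<Rightarrow> 'a \<Rightarrow> 'a set"
  assumes cover: "basic_cover S R"
    and closed: "\<And>a b. a \<in> S \<Longrightarrow> b \<in> S \<Longrightarrow> \<delta> a b \<subseteq> S"
    and comm: "\<And>a b x. a \<in> S \<Longrightarrow> b \<in> S \<Longrightarrow> x \<in> \<delta> a b \<Longrightarrow> (x, \<delta> b a) \<in> R"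
    and assoc: "\<And>a b c x. a \<in> S \<Longrightarrow> b \<in> S \<Longrightarrow> c \<in> S \<Longrightarrow> x \<in> lift_op S \<delta> (\<delta> a b) {c} \<Longrightarrow>
                  (x, lift_op S \<delta> {a} (\<delta> b c)) \<in> R"
begin

abbreviation op (infixl "\<bullet>" 65) where "U \<bullet> V \<equiv> lift_op S \<delta> U V"

definition le (infix "\<lhd>" 50) where "U \<lhd> V \<longleftrightarrow> V \<subseteq> S \<and> (\<forall>a\<in>U. (a, V) \<in> R)"

lemma op_closed: "U \<bullet> V \<subseteq> S"
  by (rule lift_op_subset[OF closed])

lemma le_carrier: "U \<lhd> V \<Longrightarrow> U \<subseteq> S" "U \<lhd> V \<Longrightarrow> V \<subseteq> S"
  unfolding le_def using basic_cover_carrier[OF cover] by blast+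

lemma subset_le: "U \<subseteq> V \<Longrightarrow> V \<subseteq> S \<Longrightarrow> U \<lhd> V"
  unfolding le_def using basic_cover_refl[OF cover] by blast

lemma le_trans [trans]: "U \<lhd> V \<Longrightarrow> V \<lhd> W \<Longrightarrow> U \<lhd> W"
  unfolding le_def using basic_cover_trans[OF cover] by blast

lemma op_leI:
  assumes "U \<subseteq> S" "V \<subseteq> S" "W \<subseteq> S" "\<And>a b. a \<in> U \<Longrightarrow> b \<in> V \<Longrightarrow> {a} \<bullet> {b} \<lhd> W"
  shows "U \<bullet> V \<lhd> W"
  using assms unfolding le_def by (force simp: lift_op_def)

lemma le_comm:
  assumes "U \<subseteq> S" "V \<subseteq> S"
  shows "U \<bullet> V \<lhd> V \<bullet> U"
proof (rule op_leI[OF assms op_closed])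
  fix a b assume ab: "a \<in> U" "b \<in> V"
  have in_S: "a \<in> S" "b \<in> S" using ab assms by auto
  have "{a} \<bullet> {b} \<lhd> {b} \<bullet> {a}"
    using comm[OF in_S] closed[OF in_S(2,1)] in_S by (simp add: le_def lift_op_singletons)
  also have "\<dots> \<lhd> V \<bullet> U"
    using ab assms by (intro subset_le lift_op_mono op_closed) auto
  finally show "{a} \<bullet> {b} \<lhd> V \<bullet> U" .
qed

lemma le_assoc:
  assumes "U \<subseteq> S" "V \<subseteq> S" "W \<subseteq> S"
  shows "(U \<bullet> V) \<bullet> W \<lhd> U \<bullet> (V \<bullet> W)"
  unfolding le_def
proof (intro conjI ballI op_closed)
  fix x assume "x \<in> (U \<bullet> V) \<bullet> W"
  then obtain y c where yc: "y \<in> U \<bullet> V" "c \<in> W" "x \<in> \<delta> y c"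
    using lift_op_iff[OF op_closed assms(3)] by blast
  then obtain a b where ab: "a \<in> U" "b \<in> V" "y \<in> \<delta> a b"
    using lift_op_iff[OF assms(1,2)] by blast
  have in_S: "a \<in> S" "b \<in> S" "c \<in> S"
    using ab yc assms by auto
  have "x \<in> \<delta> a b \<bullet> {c}"
    using lift_op_iff[of "\<delta> a b" S "{c}" x \<delta>] closed in_S ab yc by auto
  then have "(x, {a} \<bullet> \<delta> b c) \<in> R"
    using assoc in_S by blast
  moreover have "{a} \<bullet> \<delta> b c \<subseteq> U \<bullet> (V \<bullet> W)"
  proof (rule lift_op_mono[OF _ _ assms(1) op_closed])
    show "\<delta> b c \<subseteq> V \<bullet> W"
      using lift_op_iff[OF assms(2,3)] ab yc by blast
  qed (use ab in auto)
  ultimately show "(x, U \<bullet> (V \<bullet> W)) \<in> R"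
    using basic_cover_trans[OF cover _ op_closed] basic_cover_refl[OF cover op_closed] by blast
qed

text \<open>Stability is needed to commute factors inside a product, so the converse of \<open>le_assoc\<close>
  may commute the outermost product only: this rotates the three factors.\<close>

lemma le_assoc':
  assumes "U \<subseteq> S" "V \<subseteq> S" "W \<subseteq> S"
  shows "U \<bullet> (V \<bullet> W) \<lhd> (U \<bullet> V) \<bullet> W"
proof -
  note intro = assms op_closed
  have "U \<bullet> (V \<bullet> W) \<lhd> (V \<bullet> W) \<bullet> U" by (intro le_comm intro)
  also have "\<dots> \<lhd> V \<bullet> (W \<bullet> U)" by (intro le_assoc intro)
  also have "\<dots> \<lhd> (W \<bullet> U) \<bullet> V" by (intro le_comm intro)
  also have "\<dots> \<lhd> W \<bullet> (U \<bullet> V)" by (intro le_assoc intro)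
  also have "\<dots> \<lhd> (U \<bullet> V) \<bullet> W" by (intro le_comm intro)
  finally show ?thesis .
qed

text \<open>Induction on derivations reduces stability of a generated cover to stability of its axioms: if
  \<open>D \<lhd> W\<close> is stable and \<open>a \<circ> c \<lhd> D \<circ> c\<close>, then \<open>a \<circ> c \<lhd> W \<circ> c\<close>. One factor is enough by
  commutativity.\<close>

lemma op_mono_of_axioms:
  assumes gen: "R = gen_cov S ax"
    and ax: "\<And>a D c. a \<in> S \<Longrightarrow> D \<in> ax a \<Longrightarrow> D \<subseteq> S \<Longrightarrow> c \<in> S \<Longrightarrow> {a} \<bullet> {c} \<lhd> D \<bullet> {c}"
    and le: "U \<lhd> U'" "V \<lhd> V'"
  shows "U \<bullet> V \<lhd> U' \<bullet> V'"
proof -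
  have point: "{a} \<bullet> {c} \<lhd> W \<bullet> {c}" if "(a, W) \<in> gen_cov S ax" "c \<in> S" for a c W
    using that
  proof (induction rule: gen_cov.induct)
    case (refl W a)
    then show ?case by (intro subset_le lift_op_mono op_closed) auto
  next
    case (infer a W D)
    have D: "D \<subseteq> S"
      using infer.hyps gen_cov_carrier by fast
    have "{a} \<bullet> {c} \<lhd> D \<bullet> {c}"
      using ax infer.hyps infer.prems D by blast
    also have "D \<bullet> {c} \<lhd> W \<bullet> {c}"
      by (rule op_leI) (use infer D op_closed in auto)
    finally show ?case .
  qed
  have right: "A \<bullet> B \<lhd> A' \<bullet> B" if A: "A \<lhd> A'" and B: "B \<subseteq> S" for A A' B
  proof (rule op_leI[OF le_carrier(1)[OF A] B op_closed])
    fix a b assume ab: "a \<in> A" "b \<in> B"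
    have "{a} \<bullet> {b} \<lhd> A' \<bullet> {b}"
    proof (rule point)
      show "(a, A') \<in> gen_cov S ax"
        using A ab(1) unfolding le_def gen[symmetric] by blast
    qed (use ab B in auto)
    also have "\<dots> \<lhd> A' \<bullet> B"
      using ab B le_carrier(2)[OF A] by (intro subset_le lift_op_mono op_closed) auto
    finally show "{a} \<bullet> {b} \<lhd> A' \<bullet> B" .
  qed
  note carrier = le_carrier[OF le(1)] le_carrier[OF le(2)]
  have "U \<bullet> V \<lhd> U' \<bullet> V" by (rule right[OF le(1) carrier(3)])
  also have "\<dots> \<lhd> V \<bullet> U'" by (intro le_comm carrier)
  also have "\<dots> \<lhd> V' \<bullet> U'" by (rule right[OF le(2) carrier(2)])
  also have "\<dots> \<lhd> U' \<bullet> V'" by (intro le_comm carrier)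
  finally show ?thesis .
qed

lemma le_exchange:
  assumes op_mono: "\<And>A A' B B'. A \<lhd> A' \<Longrightarrow> B \<lhd> B' \<Longrightarrow> A \<bullet> B \<lhd> A' \<bullet> B'"
    and sub: "U \<subseteq> S" "V \<subseteq> S"
  shows "(U \<bullet> V) \<bullet> (U \<bullet> V) \<lhd> (U \<bullet> U) \<bullet> (V \<bullet> V)"
proof -
  note intro = sub op_closed subset_le[OF subset_refl]
  have "V \<bullet> (U \<bullet> V) \<lhd> (V \<bullet> U) \<bullet> V" by (intro le_assoc' intro)
  also have "\<dots> \<lhd> (U \<bullet> V) \<bullet> V" by (rule op_mono) (intro le_comm intro)+
  also have "\<dots> \<lhd> U \<bullet> (V \<bullet> V)" by (intro le_assoc intro)
  finally have swap: "V \<bullet> (U \<bullet> V) \<lhd> U \<bullet> (V \<bullet> V)" .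
  have "(U \<bullet> V) \<bullet> (U \<bullet> V) \<lhd> U \<bullet> (V \<bullet> (U \<bullet> V))" by (intro le_assoc intro)
  also have "\<dots> \<lhd> U \<bullet> (U \<bullet> (V \<bullet> V))" by (rule op_mono) (intro swap intro)+
  also have "\<dots> \<lhd> (U \<bullet> U) \<bullet> (V \<bullet> V)" by (intro le_assoc' intro)
  finally show ?thesis .
qed

end

lemma axiom_set_ax_J:
  assumes "axiom_set S ax" and "\<And>a b. a \<in> S \<Longrightarrow> b \<in> S \<Longrightarrow> \<delta> a b \<subseteq> S"
  shows "axiom_set S (ax_J S (lift_op S \<delta>) ax)"
    and "axiom_set S (ax_J' S (lift_op S \<delta>) ax)"
    and "axiom_set S (ax_J'' S (lift_op S \<delta>) ax)"
proof -
  have m: "lift_op S \<delta> U V \<subseteq> S" for U V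
    by (rule lift_op_subset[OF assms(2)])
  show 1: "axiom_set S (ax_J S (lift_op S \<delta>) ax)"
    using assms(1) m unfolding axiom_set_def ax_J_def by blast
  show 2: "axiom_set S (ax_J' S (lift_op S \<delta>) ax)"
    using 1 m unfolding axiom_set_def ax_J'_def by blast
  show "axiom_set S (ax_J'' S (lift_op S \<delta>) ax)"
    using 2 m unfolding axiom_set_def ax_J''_def by blast
qed

lemma comm_semigroup_cover_gen_cov:
  assumes closed: "\<And>a b. a \<in> S \<Longrightarrow> b \<in> S \<Longrightarrow> \<delta> a b \<subseteq> S"
    and ax: "\<And>a. a \<in> S \<Longrightarrow> ax_J S (lift_op S \<delta>) ax a \<subseteq> ax' a"
  shows "comm_semigroup_cover S (gen_cov S ax') \<delta>"
proof
  show "basic_cover S (gen_cov S ax')" by (rule basic_cover_gen_cov)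
  show "\<delta> a b \<subseteq> S" if "a \<in> S" "b \<in> S" for a b using that by (rule closed)
  have m: "lift_op S \<delta> U V \<subseteq> S" for U V
    by (rule lift_op_subset[OF closed])
  have gen: "(x, D) \<in> gen_cov S ax'" if "D \<in> ax_J S (lift_op S \<delta>) ax x" "x \<in> S" "D \<subseteq> S" for x D
    using gen_cov_axiom[OF that(2) _ that(3)] ax[OF that(2)] that(1) by auto
  show "(x, \<delta> b a) \<in> gen_cov S ax'" if "a \<in> S" "b \<in> S" "x \<in> \<delta> a b" for a b x
  proof (rule gen)
    show "\<delta> b a \<in> ax_J S (lift_op S \<delta>) ax x"
      unfolding ax_J_def using that by (force simp: lift_op_singletons)
  qed (use that closed in auto)
  show "(x, lift_op S \<delta> {a} (\<delta> b c)) \<in> gen_cov S ax'"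
    if "a \<in> S" "b \<in> S" "c \<in> S" "x \<in> lift_op S \<delta> (\<delta> a b) {c}" for a b c x
  proof (rule gen)
    show "lift_op S \<delta> {a} (\<delta> b c) \<in> ax_J S (lift_op S \<delta>) ax x"
      unfolding ax_J_def using that by (force simp: lift_op_singletons)
  qed (use that m in auto)
qed

text \<open>The axioms of \<open>J\<close> are stable because \<open>J'\<close> contains their localisations. A localised axiom
  \<open>a \<lhd> E \<circ> d\<close>, with \<open>a \<in> b \<circ> d\<close> and \<open>E \<in> J(b)\<close>, is stable under \<open>c\<close> because localising first at
  \<open>d\<close> and then at \<open>c\<close> is localising at the elements of \<open>d \<circ> c\<close>.\<close>

lemma op_mono_gen_cov_J':
  fixes S ax \<delta>
  defines "R \<equiv> gen_cov S (ax_J' S (lift_op S \<delta>) ax)"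
  assumes ax: "axiom_set S ax" and closed: "\<And>a b. a \<in> S \<Longrightarrow> b \<in> S \<Longrightarrow> \<delta> a b \<subseteq> S"
    and le: "comm_semigroup_cover.le S R U U'" "comm_semigroup_cover.le S R V V'"
  shows "comm_semigroup_cover.le S R (lift_op S \<delta> U V) (lift_op S \<delta> U' V')"
proof -
  interpret comm_semigroup_cover S R \<delta>
    unfolding R_def
    by (rule comm_semigroup_cover_gen_cov[of _ _ ax]) (use closed in \<open>auto simp: ax_J'_def\<close>)
  have stable: "{b} \<bullet> {c} \<lhd> D \<bullet> {c}"
    if "b \<in> S" "c \<in> S" "D \<in> ax_J S (lift_op S \<delta>) ax b" for b c D
    unfolding le_def
  proof (intro conjI ballI op_closed)
    fix x assume "x \<in> {b} \<bullet> {c}"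
    then have "D \<bullet> {c} \<in> ax_J' S (lift_op S \<delta>) ax x" "x \<in> S"
      using that op_closed unfolding ax_J'_def by blast+
    then show "(x, D \<bullet> {c}) \<in> R"
      unfolding R_def using op_closed by (intro gen_cov_axiom)
  qed
  show ?thesis
  proof (rule op_mono_of_axioms[OF R_def[THEN meta_eq_to_obj_eq] _ le])
    fix a D c assume a: "a \<in> S" and D: "D \<in> ax_J' S (lift_op S \<delta>) ax a" and c: "c \<in> S"
    from D consider (J) "D \<in> ax_J S (lift_op S \<delta>) ax a"
      | (J') b d E where "b \<in> S" "d \<in> S" "a \<in> {b} \<bullet> {d}" "E \<in> ax_J S (lift_op S \<delta>) ax b"
          "D = E \<bullet> {d}"
      unfolding ax_J'_def by blast
    then show "{a} \<bullet> {c} \<lhd> D \<bullet> {c}"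
    proof cases
      case J
      then show ?thesis using stable a c by blast
    next
      case J'
      have E: "E \<subseteq> S"
        using J'(1,4) axiom_set_ax_J(1)[of S ax \<delta>] ax closed unfolding axiom_set_def by blast
      have "{a} \<bullet> {c} \<lhd> ({b} \<bullet> {d}) \<bullet> {c}"
        using J' c by (intro subset_le lift_op_mono op_closed) auto
      also have "\<dots> \<lhd> {b} \<bullet> ({d} \<bullet> {c})"
        using J' c by (intro le_assoc) auto
      also have "\<dots> \<lhd> E \<bullet> ({d} \<bullet> {c})"
      proof (rule op_leI[OF _ op_closed op_closed])
        fix x y assume xy: "x \<in> {b}" "y \<in> {d} \<bullet> {c}"
        then have y: "y \<in> S" using op_closed by blast
        have "{x} \<bullet> {y} \<lhd> E \<bullet> {y}"
          using xy y J' stable by blast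
        also have "\<dots> \<lhd> E \<bullet> ({d} \<bullet> {c})"
          using xy E by (intro subset_le lift_op_mono op_closed) auto
        finally show "{x} \<bullet> {y} \<lhd> E \<bullet> ({d} \<bullet> {c})" .
      qed (use J' in auto)
      also have "\<dots> \<lhd> (E \<bullet> {d}) \<bullet> {c}"
        using J' c E by (intro le_assoc') auto
      finally show ?thesis using J' by simp
    qed
  qed
qed

text \<open>Given stability, weakening yields the lower bounds, and contraction yields
  \<open>a \<lhd> a \<circ> a \<lhd> U \<circ> V\<close> from \<open>a \<lhd> U\<close> and \<open>a \<lhd> V\<close>. It remains to extend stability from the cover \<open>R'\<close>
  generated by \<open>J'\<close> to weakening and contraction.\<close>

lemma meet_op_gen_formal_cover:
  fixes S ax \<delta>
  defines "R \<equiv> gen_cov S (ax_J'' S (lift_op S \<delta>) ax)"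
  assumes ax: "axiom_set S ax" and closed: "\<And>a b. a \<in> S \<Longrightarrow> b \<in> S \<Longrightarrow> \<delta> a b \<subseteq> S"
  shows "meet_op S R (lift_op S \<delta>)"
proof -
  define R' where "R' = gen_cov S (ax_J' S (lift_op S \<delta>) ax)"
  interpret comm_semigroup_cover S R \<delta>
    unfolding R_def
    by (rule comm_semigroup_cover_gen_cov[of _ _ ax])
      (use closed in \<open>auto simp: ax_J'_def ax_J''_def\<close>)
  have "comm_semigroup_cover S R' \<delta>"
    unfolding R'_def
    by (rule comm_semigroup_cover_gen_cov[of _ _ ax]) (use closed in \<open>auto simp: ax_J'_def\<close>)
  note le_J'_def = comm_semigroup_cover.le_def[OF this]
    and subset_le_J' = comm_semigroup_cover.subset_le[OF this]
    and exchange = comm_semigroup_cover.le_exchange[OF this]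
  have sub: "R' \<subseteq> R"
    unfolding R'_def R_def by (rule gen_cov_mono) (auto simp: ax_J''_def)
  then have from_J': "U \<lhd> V" if "comm_semigroup_cover.le S R' U V" for U V
    using that unfolding le_def le_J'_def by blast
  have op_mono': "comm_semigroup_cover.le S R' (U \<bullet> V) (U' \<bullet> V')"
    if "comm_semigroup_cover.le S R' U U'" "comm_semigroup_cover.le S R' V V'" for U U' V V'
    using that unfolding R'_def by (intro op_mono_gen_cov_J' ax closed)
  have le_axiom: "U \<lhd> D" if "U \<subseteq> S" "D \<subseteq> S" "\<And>a. a \<in> U \<Longrightarrow> D \<in> ax_J'' S (lift_op S \<delta>) ax a" for U D
    unfolding le_def
  proof (intro conjI ballI that(2))
    fix a assume a: "a \<in> U"
    then show "(a, D) \<in> R"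
      unfolding R_def using that(1,2) by (intro gen_cov_axiom that(3)) auto
  qed
  have weakening: "U \<bullet> V \<lhd> V" if "U \<subseteq> S" "V \<subseteq> S" for U V
  proof (rule op_leI[OF that that(2)])
    fix a b assume "a \<in> U" "b \<in> V"
    then have "{a} \<bullet> {b} \<lhd> {b}"
      using that by (intro le_axiom op_closed) (auto simp: ax_J''_def)
    also have "\<dots> \<lhd> V"
      using \<open>b \<in> V\<close> that by (intro subset_le) auto
    finally show "{a} \<bullet> {b} \<lhd> V" .
  qed
  have contraction: "{a} \<lhd> {a} \<bullet> {a}" if "a \<in> S" for a
    using that by (intro le_axiom op_closed) (auto simp: ax_J''_def)
  have op_mono: "U \<bullet> V \<lhd> U' \<bullet> V'" if "U \<lhd> U'" "V \<lhd> V'" for U U' V V'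
  proof (rule op_mono_of_axioms[OF R_def[THEN meta_eq_to_obj_eq] _ that])
    fix a D c assume a: "a \<in> S" and D: "D \<in> ax_J'' S (lift_op S \<delta>) ax a" "D \<subseteq> S" and c: "c \<in> S"
    from D consider (J') "D \<in> ax_J' S (lift_op S \<delta>) ax a"
      | (weak) b d where "b \<in> S" "d \<in> S" "a \<in> {b} \<bullet> {d}" "D = {d}"
      | (contr) "D = {a} \<bullet> {a}"
      unfolding ax_J''_def by blast
    then show "{a} \<bullet> {c} \<lhd> D \<bullet> {c}"
    proof cases
      case J'
      have "comm_semigroup_cover.le S R' {a} D"
        using gen_cov_axiom[of a S D "ax_J' S (lift_op S \<delta>) ax"] a J' D(2)
        unfolding le_J'_def unfolding R'_def by simp
      moreover have "comm_semigroup_cover.le S R' {c} {c}"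
        using c by (intro subset_le_J') auto
      ultimately show ?thesis
        by (intro from_J' op_mono')
    next
      case weak
      have "{a} \<bullet> {c} \<lhd> ({b} \<bullet> {d}) \<bullet> {c}"
        using weak c by (intro subset_le lift_op_mono op_closed) auto
      also have "\<dots> \<lhd> {b} \<bullet> ({d} \<bullet> {c})"
        using weak c by (intro le_assoc) auto
      also have "\<dots> \<lhd> {d} \<bullet> {c}"
        using weak by (intro weakening op_closed) auto
      finally show ?thesis using weak by simp
    next
      case contr
      \<comment> \<open>Contracting the elements of \<open>a \<circ> c\<close> duplicates \<open>c\<close> as well; after regrouping, weakening
        removes the second copy of \<open>c\<close>.\<close>
      have "{a} \<bullet> {c} \<lhd> ({a} \<bullet> {c}) \<bullet> ({a} \<bullet> {c})" (is "?X \<lhd> _")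
        unfolding le_def
      proof (intro conjI ballI op_closed)
        fix x assume x: "x \<in> ?X"
        then have "x \<in> S" using op_closed by blast
        have "{x} \<lhd> {x} \<bullet> {x}" using contraction \<open>x \<in> S\<close> .
        also have "\<dots> \<lhd> ?X \<bullet> ?X"
          using x by (intro subset_le lift_op_mono op_closed) auto
        finally show "(x, ?X \<bullet> ?X) \<in> R" unfolding le_def by blast
      qed
      also have "\<dots> \<lhd> ({a} \<bullet> {a}) \<bullet> ({c} \<bullet> {c})"
        \<comment> \<open>Regrouping commutes factors inside a product, so it takes place in \<open>R'\<close>, where stability
          is known.\<close>
        by (intro from_J' exchange op_mono') (use a c in auto)
      also have "\<dots> \<lhd> (({a} \<bullet> {a}) \<bullet> {c}) \<bullet> {c}"
        using c by (intro le_assoc' op_closed) auto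
      also have "\<dots> \<lhd> {c} \<bullet> (({a} \<bullet> {a}) \<bullet> {c})"
        using c by (intro le_comm op_closed) auto
      also have "\<dots> \<lhd> ({a} \<bullet> {a}) \<bullet> {c}"
        using c by (intro weakening op_closed) auto
      finally show ?thesis using contr by simp
    qed
  qed
  show ?thesis
    unfolding meet_op_def
  proof (intro allI impI conjI iffI op_closed)
    fix U V a assume UV: "U \<subseteq> S" "V \<subseteq> S"
    have "U \<bullet> V \<lhd> V" using UV by (rule weakening)
    moreover have "U \<bullet> V \<lhd> U"
      by (rule le_trans[OF le_comm weakening]) (use UV in auto)
    moreover assume "(a, U \<bullet> V) \<in> R"
    ultimately show "(a, U) \<in> R" "(a, V) \<in> R"
      using UV basic_cover_trans[OF cover, of a "U \<bullet> V" U] basic_cover_trans[OF cover, of a "U \<bullet> V" V]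
      unfolding le_def by simp_all
  next
    fix U V a assume UV: "U \<subseteq> S" "V \<subseteq> S" and a: "(a, U) \<in> R \<and> (a, V) \<in> R"
    have "{a} \<lhd> {a} \<bullet> {a}"
      using contraction basic_cover_carrier(1)[OF cover] a by blast
    also have "\<dots> \<lhd> U \<bullet> V"
      using a UV by (intro op_mono) (auto simp: le_def)
    finally show "(a, U \<bullet> V) \<in> R" unfolding le_def by blast
  qed
qed


subsection \<open>The universal property\<close>

lemma gen_formal_cover_simps [simp]:
  "carrier (gen_formal_cover S ax \<delta>) = S"
  "cov (gen_formal_cover S ax \<delta>) = gen_cov S (ax_J'' S (lift_op S \<delta>) ax)"
  "circ (gen_formal_cover S ax \<delta>) = lift_op S \<delta>"
  unfolding gen_formal_cover_def by simp_all

lemma formal_cover_gen_formal_cover: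
  assumes "axiom_set S ax" "\<And>a b. a \<in> S \<Longrightarrow> b \<in> S \<Longrightarrow> \<delta> a b \<subseteq> S"
  shows "formal_cover (gen_formal_cover S ax \<delta>)"
  by (rule formal_coverI[where \<delta> = \<delta>])
    (use basic_cover_gen_cov meet_op_gen_formal_cover[OF assms] in auto)

text \<open>With \<open>meet_op_gen_formal_cover\<close> this characterises the generated cover. All the added axioms hold
  in \<open>R\<close> because \<open>a \<in> b \<circ> c\<close> gives \<open>a \<lhd> b\<close> and \<open>a \<lhd> c\<close>, from which the right-hand side of each
  axiom is recovered as a meet.\<close>

lemma gen_formal_cover_least:
  assumes R: "basic_cover S R" and m: "meet_op S R (lift_op S \<delta>)"
    and ax: "\<And>a D. a \<in> S \<Longrightarrow> D \<in> ax a \<Longrightarrow> (a, D) \<in> R"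
  shows "cov (gen_formal_cover S ax \<delta>) \<subseteq> R"
proof -
  let ?m = "lift_op S \<delta>"
  note meetD = meet_opD[OF m] and lower = meet_op_lower[OF R m]
  have J: "(a, D) \<in> R" if a: "a \<in> S" and D: "D \<in> ax_J S ?m ax a" for a D
  proof -
    from D consider "D \<in> ax a"
      | (comm) b c where "b \<in> S" "c \<in> S" "a \<in> ?m {b} {c}" "D = ?m {c} {b}"
      | (assoc) b c d where "b \<in> S" "c \<in> S" "d \<in> S" "a \<in> ?m (?m {b} {c}) {d}"
          "D = ?m {b} (?m {c} {d})"
      unfolding ax_J_def by blast
    then show ?thesis
    proof cases
      case 1
      then show ?thesis using ax a by blast
    next
      case comm
      then show ?thesis using lower[of "{b}" "{c}" a] meetD(2)[of "{c}" "{b}" a] by auto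
    next
      case assoc
      then show ?thesis
        using lower[of "?m {b} {c}" "{d}" a] meetD(1)[of "{b}" "{c}"] meetD(1)[of "{c}" "{d}"]
        by (simp add: meetD(2))
    qed
  qed
  have J': "(a, D) \<in> R" if a: "a \<in> S" and D: "D \<in> ax_J' S ?m ax a" for a D
  proof -
    from D consider "D \<in> ax_J S ?m ax a"
      | (stable) b c E where "b \<in> S" "c \<in> S" "a \<in> ?m {b} {c}" "E \<in> ax_J S ?m ax b" "D = ?m E {c}"
      unfolding ax_J'_def by blast
    then show ?thesis
    proof cases
      case 1
      then show ?thesis using J a by blast
    next
      case stable
      have E: "(b, E) \<in> R" "E \<subseteq> S"
        using J basic_cover_carrier(2)[OF R] stable by blast+
      have "(a, {b}) \<in> R" "(a, {c}) \<in> R"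
        using lower[of "{b}" "{c}" a] stable by auto
      then show ?thesis
        using basic_cover_trans[OF R, of a "{b}" E] E stable meetD(2)[of E "{c}" a] by auto
    qed
  qed
  have "(a, D) \<in> R" if a: "a \<in> S" and D: "D \<in> ax_J'' S ?m ax a" for a D
    using D J'[OF a] lower[of "{_}" "{_}" a] a basic_cover_refl[OF R, of "{a}" a]
      meetD(2)[of "{a}" "{a}" a]
    unfolding ax_J''_def by auto
  then show ?thesis
    using gen_cov_least[OF R] by simp
qed


section \<open>Inverse images\<close>

lemma preim_subset: "r \<subseteq> A \<times> B \<Longrightarrow> preim r V \<subseteq> A"
  unfolding preim_def by auto

lemma preim_mono: "U \<subseteq> V \<Longrightarrow> preim r U \<subseteq> preim r V"
  unfolding preim_def by auto

lemma preim_UN: "preim r (\<Union>i\<in>K. A i) = (\<Union>i\<in>K. preim r (A i))"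
  unfolding preim_def by auto

lemma preim_singletons: "(\<Union>b\<in>V. preim r {b}) = preim r V"
  unfolding preim_def by auto

lemma preim_comp: "preim (r O s) V = preim r (preim s V)"
  unfolding preim_def by auto

lemma preim_Id_on: "U \<subseteq> S \<Longrightarrow> preim (Id_on S) U = U"
  unfolding preim_def by auto

text \<open>The largest basic cover on \<open>T\<close> for which \<open>r\<close> is a basic cover map out of \<open>X\<close>. It turns the
  condition on basic cover maps into an inclusion of covers, which minimality can prove.\<close>

definition pull_cov :: "'a cover \<Rightarrow> 'a set \<Rightarrow> ('a \<times> 'a) set \<Rightarrow> ('a \<times> 'a set) set" where
  "pull_cov X T r = {(b, V). b \<in> T \<and> V \<subseteq> T \<and> covers X (preim r {b}) (preim r V)}"

lemma covers_preim_singletons: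
  "covers X (preim r U) W \<longleftrightarrow> (\<forall>b\<in>U. covers X (preim r {b}) W)"
  unfolding covers_def preim_def by auto

lemma basic_cover_pull_cov:
  assumes X: "is_cover X" and r: "r \<subseteq> carrier X \<times> T"
  shows "basic_cover T (pull_cov X T r)"
proof -
  have refl: "covers X (preim r {b}) (preim r V)" if "b \<in> V" for b V
    unfolding covers_def
  proof
    fix x assume "x \<in> preim r {b}"
    then have "x \<in> preim r V"
      using that preim_mono[of "{b}" V r] by auto
    then show "(x, preim r V) \<in> cov X"
      by (rule basic_cover_refl[OF X preim_subset[OF r]])
  qed
  have trans: "covers X (preim r {b}) (preim r V)"
    if b: "covers X (preim r {b}) (preim r U)"
      and U: "\<forall>c\<in>U. covers X (preim r {c}) (preim r V)" for b U V
    unfolding covers_def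
  proof
    fix x assume "x \<in> preim r {b}"
    then have "(x, preim r U) \<in> cov X"
      using b unfolding covers_def by blast
    moreover have "\<forall>y\<in>preim r U. (y, preim r V) \<in> cov X"
      using U covers_preim_singletons[of X r U] unfolding covers_def by blast
    ultimately show "(x, preim r V) \<in> cov X"
      using basic_cover_trans[OF X, of x "preim r U" "preim r V"] preim_subset[OF r] by simp
  qed
  show ?thesis
    unfolding basic_cover_def
  proof (intro conjI allI impI ballI)
    show "pull_cov X T r \<subseteq> T \<times> Pow T"
      unfolding pull_cov_def by auto
    show "(a, U) \<in> pull_cov X T r" if "U \<subseteq> T" "a \<in> U" for a U
      using that refl unfolding pull_cov_def by auto
    show "(a, V) \<in> pull_cov X T r"
      if "(a, U) \<in> pull_cov X T r" "V \<subseteq> T" "\<forall>b\<in>U. (b, V) \<in> pull_cov X T r" for a U V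
    proof -
      have "a \<in> T" "covers X (preim r {a}) (preim r U)"
        "\<forall>c\<in>U. covers X (preim r {c}) (preim r V)"
        using that unfolding pull_cov_def by simp_all
      then show ?thesis
        using trans that(2) unfolding pull_cov_def by simp
    qed
  qed
qed

lemma basic_map_iff_pull_cov:
  assumes "is_cover Y"
  shows "basic_map X Y r \<longleftrightarrow> r \<subseteq> carrier X \<times> carrier Y \<and> cov Y \<subseteq> pull_cov X (carrier Y) r"
  unfolding basic_map_def pull_cov_def using basic_cover_carrier[OF assms] by blast

lemma eqA_iff_cov: "is_cover X \<Longrightarrow> eqA X U V \<longleftrightarrow> (\<forall>a. (a, U) \<in> cov X \<longleftrightarrow> (a, V) \<in> cov X)"
  unfolding eqA_def sat_def using basic_cover_carrier(1) by fastforce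

lemma covers_cong: "is_cover X \<Longrightarrow> eqA X U V \<Longrightarrow> covers X W U \<longleftrightarrow> covers X W V"
  unfolding covers_def by (simp add: eqA_iff_cov)

lemma meet_op_pull_cov:
  assumes X: "is_cover X" and r: "r \<subseteq> carrier X \<times> T" and m: "meet_op (carrier X) (cov X) m"
    and n: "\<And>U V. U \<subseteq> T \<Longrightarrow> V \<subseteq> T \<Longrightarrow> n U V \<subseteq> T"
    and pres: "\<And>U V. U \<subseteq> T \<Longrightarrow> V \<subseteq> T \<Longrightarrow> eqA X (preim r (n U V)) (m (preim r U) (preim r V))"
  shows "meet_op T (pull_cov X T r) n"
  unfolding meet_op_def
proof (intro allI impI conjI)
  fix U V b assume UV: "U \<subseteq> T" "V \<subseteq> T"
  then show "n U V \<subseteq> T" by (rule n)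
  have "covers X W (preim r (n U V)) \<longleftrightarrow> covers X W (preim r U) \<and> covers X W (preim r V)" for W
    unfolding covers_cong[OF X pres[OF UV]] unfolding covers_def
    by (auto simp: meet_opD(2)[OF m preim_subset[OF r] preim_subset[OF r]])
  then show "(b, n U V) \<in> pull_cov X T r \<longleftrightarrow> (b, U) \<in> pull_cov X T r \<and> (b, V) \<in> pull_cov X T r"
    unfolding pull_cov_def using UV n[OF UV] by auto
qed

lemma basic_map_subset: "basic_map X Y r \<Longrightarrow> r \<subseteq> carrier X \<times> carrier Y"
  unfolding basic_map_def by simp

lemma basic_map_preim_subset: "basic_map X Y r \<Longrightarrow> preim r V \<subseteq> carrier X"
  by (rule preim_subset[OF basic_map_subset])

lemma basic_map_covers:
  assumes "basic_map X Y r" "covers Y U V"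
  shows "covers X (preim r U) (preim r V)"
  using assms covers_preim_singletons[of X r U] unfolding basic_map_def covers_def[of Y] by simp

lemma eqA_iff_covers:
  assumes "is_cover X" "U \<subseteq> carrier X" "V \<subseteq> carrier X"
  shows "eqA X U V \<longleftrightarrow> covers X U V \<and> covers X V U"
  unfolding eqA_iff[OF assms] using assms(2,3) unfolding covers_def sat_def by auto

lemma basic_map_eqA:
  assumes "is_cover X" "is_cover Y" "basic_map X Y r"
    and "U \<subseteq> carrier Y" "V \<subseteq> carrier Y" "eqA Y U V"
  shows "eqA X (preim r U) (preim r V)"
  using assms basic_map_covers[OF assms(3)] by (simp add: eqA_iff_covers basic_map_preim_subset)

lemma basic_map_Id_on: "is_cover X \<Longrightarrow> basic_map X X (Id_on (carrier X))"
  unfolding basic_map_def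
proof (intro conjI allI impI)
  fix b V assume "is_cover X" "(b, V) \<in> cov X"
  then show "covers X (preim (Id_on (carrier X)) {b}) (preim (Id_on (carrier X)) V)"
    using basic_cover_carrier[of "carrier X" "cov X" b V] by (simp add: preim_Id_on covers_def)
qed auto

lemma basic_map_comp:
  assumes r: "basic_map X Y r" and s: "basic_map Y Z s"
  shows "basic_map X Z (r O s)"
  unfolding basic_map_def
proof (intro conjI allI impI)
  show "r O s \<subseteq> carrier X \<times> carrier Z"
    using basic_map_subset[OF r] basic_map_subset[OF s] by auto
  show "covers X (preim (r O s) {b}) (preim (r O s) V)" if "(b, V) \<in> cov Z" for b V
    unfolding preim_comp
    by (rule basic_map_covers[OF r], rule basic_map_covers[OF s]) (use that in \<open>simp add: covers_def\<close>)
qed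


section \<open>Covers with a distributive operation\<close>

abbreviation pointwise :: "'a cover \<Rightarrow> 'a set \<Rightarrow> 'a set \<Rightarrow> 'a set" where
  "pointwise X \<equiv> lift_op (carrier X) (\<lambda>a b. circ X {a} {b})"

lemma circ_coverD:
  assumes "circ_cover X"
  shows "is_cover X"
    and "\<And>U V. U \<subseteq> carrier X \<Longrightarrow> V \<subseteq> carrier X \<Longrightarrow> circ X U V \<subseteq> carrier X"
    and "\<And>\<U> V. \<U> \<subseteq> Pow (carrier X) \<Longrightarrow> V \<subseteq> carrier X \<Longrightarrow>
           eqA X (\<Union>U\<in>\<U>. circ X U V) (circ X (\<Union>\<U>) V)"
    and "\<And>U V. U \<subseteq> carrier X \<Longrightarrow> V \<subseteq> carrier X \<Longrightarrow> eqA X (circ X U V) (circ X V U)"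
    and "\<exists>E. is_unit X E"
  using assms unfolding circ_cover_def op_cover_def by simp_all

lemma circ_eqA_UN_left:
  assumes "circ_cover X" "U \<subseteq> carrier X" "V \<subseteq> carrier X"
  shows "eqA X (circ X U V) (\<Union>a\<in>U. circ X {a} V)"
proof -
  have "eqA X (\<Union>W\<in>(\<lambda>a. {a}) ` U. circ X W V) (circ X (\<Union>((\<lambda>a. {a}) ` U)) V)"
    by (rule circ_coverD(3)) (use assms in auto)
  then show ?thesis by (simp add: eqA_sym)
qed

text \<open>Distributivity applies in the left argument, and by commutativity in the right one. Since the
  operation need not respect \<open>eqA\<close>, no argument of it is replaced by an equal one.\<close>

lemma circ_eqA_pointwise:
  assumes X: "circ_cover X" and UV: "U \<subseteq> carrier X" "V \<subseteq> carrier X"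
  shows "eqA X (circ X U V) (pointwise X U V)"
proof -
  note circ_coverD[OF X, simp]
  have sub: "circ X {a} W \<subseteq> carrier X" "circ X W {a} \<subseteq> carrier X"
    if "a \<in> carrier X" "W \<subseteq> carrier X" for a W
    using that by simp_all
  have row: "eqA X (circ X {a} V) (\<Union>b\<in>V. circ X {a} {b})" if "a \<in> U" for a
  proof -
    have a: "a \<in> carrier X" using that UV by auto
    then have "eqA X (circ X {a} V) (circ X V {a})"
      using UV by simp
    also have "eqA X \<dots> (\<Union>b\<in>V. circ X {b} {a})"
      using a UV by (intro circ_eqA_UN_left X) auto
    also have "eqA X \<dots> (\<Union>b\<in>V. circ X {a} {b})"
    proof (rule eqA_UN)
      fix b assume "b \<in> V"
      then have b: "b \<in> carrier X" using UV by auto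
      show "circ X {b} {a} \<subseteq> carrier X" "circ X {a} {b} \<subseteq> carrier X"
        "eqA X (circ X {b} {a}) (circ X {a} {b})"
        using a b by simp_all
    qed simp
    finally show ?thesis .
  qed
  have "eqA X (circ X U V) (\<Union>a\<in>U. circ X {a} V)"
    by (rule circ_eqA_UN_left[OF X UV])
  also have "eqA X \<dots> (\<Union>a\<in>U. \<Union>b\<in>V. circ X {a} {b})"
  proof (rule eqA_UN)
    fix a assume a: "a \<in> U"
    then have "a \<in> carrier X" using UV by auto
    then show "circ X {a} V \<subseteq> carrier X" "(\<Union>b\<in>V. circ X {a} {b}) \<subseteq> carrier X"
      using sub(1) UV by (simp, intro UN_least sub(1)) auto
    show "eqA X (circ X {a} V) (\<Union>b\<in>V. circ X {a} {b})"
      by (rule row[OF a])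
  qed simp
  also have "(\<Union>a\<in>U. \<Union>b\<in>V. circ X {a} {b}) = pointwise X U V"
    using UV by (simp add: lift_op_def)
  finally show ?thesis .
qed

lemma is_unitD:
  assumes "is_unit X E"
  shows "E \<subseteq> carrier X" "a \<in> carrier X \<Longrightarrow> eqA X {a} (circ X {a} E)"
  using assms unfolding is_unit_def by simp_all

text \<open>The unit law is given on elements; it passes to subsets by distributivity.\<close>

lemma unit_right:
  assumes X: "circ_cover X" and E: "is_unit X E" and U: "U \<subseteq> carrier X"
  shows "eqA X U (circ X U E)"
proof -
  have "eqA X (\<Union>a\<in>U. {a}) (\<Union>a\<in>U. circ X {a} E)"
  proof (rule eqA_UN[OF circ_coverD(1)[OF X]])
    fix a assume "a \<in> U"
    then have a: "a \<in> carrier X" using U by auto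
    show "{a} \<subseteq> carrier X" "circ X {a} E \<subseteq> carrier X" "eqA X {a} (circ X {a} E)"
      using a is_unitD[OF E] circ_coverD(2)[OF X] by simp_all
  qed
  also have "eqA X \<dots> (circ X U E)"
    by (rule eqA_sym[OF circ_eqA_UN_left[OF X U is_unitD(1)[OF E]]])
  finally show ?thesis by simp
qed

lemma unit_unique:
  assumes X: "circ_cover X" and "is_unit X E" "is_unit X F"
  shows "eqA X E F"
proof -
  note sub = is_unitD(1)[OF assms(2)] is_unitD(1)[OF assms(3)]
  have "eqA X E (circ X E F)" by (rule unit_right[OF X assms(3) sub(1)])
  also have "eqA X \<dots> (circ X F E)" by (rule circ_coverD(4)[OF X sub])
  also have "eqA X \<dots> F" by (rule eqA_sym[OF unit_right[OF X assms(2) sub(2)]])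
  finally show ?thesis .
qed


section \<open>The formal reflection of a cover\<close>

lemma Obj_BCov:
  "X \<in> Obj BCov \<longleftrightarrow>
     circ_cover X \<and> (\<exists>ax. axiom_set (carrier X) ax \<and> cov X = gen_cov (carrier X) ax)"
  unfolding BCov_def cover_cat_def by simp

lemma Obj_FCov:
  "X \<in> Obj FCov \<longleftrightarrow> formal_cover X \<and>
     (\<exists>ax \<delta>. axiom_set (carrier X) ax \<and>
        (\<forall>a\<in>carrier X. \<forall>b\<in>carrier X. \<delta> a b \<subseteq> carrier X) \<and>
        X = gen_formal_cover (carrier X) ax \<delta>)"
  unfolding FCov_def cover_cat_def by simp

lemma presents_exists:
  assumes "X \<in> Obj BCov"
  shows "\<exists>ax E. presents X ax E"
  using assms circ_coverD(5)[of X] unfolding Obj_BCov presents_def by blast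

lemma axiom_set_unit_axioms:
  assumes X: "circ_cover X" and "presents X ax E"
  shows "axiom_set (carrier X) (\<lambda>a. ax a \<union> unit_axioms X E a)"
proof -
  have "axiom_set (carrier X) ax" "E \<subseteq> carrier X"
    using assms(2) is_unitD unfolding presents_def by blast+
  then show ?thesis
    using circ_coverD(2)[OF X] unfolding axiom_set_def unit_axioms_def by simp blast
qed

lemma circ_singletons_closed:
  "circ_cover X \<Longrightarrow> a \<in> carrier X \<Longrightarrow> b \<in> carrier X \<Longrightarrow> circ X {a} {b} \<subseteq> carrier X"
  by (rule circ_coverD(2)) auto

lemma LQ_gen_simps:
  "carrier (LQ_gen X ax E) = carrier X"
  "circ (LQ_gen X ax E) = pointwise X"
  unfolding LQ_gen_def by simp_all

lemma is_cover_LQ_gen: "is_cover (LQ_gen X ax E)"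
  unfolding LQ_gen_def by (simp add: basic_cover_gen_cov)

lemma LQ_gen_in_FCov:
  assumes X: "circ_cover X" and P: "presents X ax E"
  shows "LQ_gen X ax E \<in> Obj FCov"
proof -
  note closed = circ_singletons_closed[OF X]
  have "formal_cover (LQ_gen X ax E)"
    unfolding LQ_gen_def
    by (rule formal_cover_gen_formal_cover[OF axiom_set_unit_axioms[OF X P] closed])
  moreover have "\<forall>a\<in>carrier X. \<forall>b\<in>carrier X. circ X {a} {b} \<subseteq> carrier X"
    using closed by blast
  ultimately show ?thesis
    unfolding Obj_FCov LQ_gen_simps
    using axiom_set_unit_axioms[OF X P]
    by (intro conjI exI[of _ "\<lambda>a. ax a \<union> unit_axioms X E a"] exI[of _ "\<lambda>a b. circ X {a} {b}"])
      (simp_all add: LQ_gen_def)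
qed

lemma meet_op_LQ_gen:
  assumes "circ_cover X" "presents X ax E"
  shows "meet_op (carrier X) (cov (LQ_gen X ax E)) (pointwise X)"
  unfolding LQ_gen_def gen_formal_cover_simps
  by (rule meet_op_gen_formal_cover[OF axiom_set_unit_axioms[OF assms] circ_singletons_closed[OF assms(1)]])

lemma cov_subset_LQ_gen:
  assumes "presents X ax E"
  shows "cov X \<subseteq> cov (LQ_gen X ax E)"
proof -
  have "cov X = gen_cov (carrier X) ax"
    using assms unfolding presents_def by simp
  also have "\<dots> \<subseteq> cov (LQ_gen X ax E)"
    unfolding LQ_gen_def gen_formal_cover_simps
    by (rule gen_cov_mono) (auto simp: ax_J_def ax_J'_def ax_J''_def)
  finally show ?thesis .
qed

text \<open>With \<open>cov_subset_LQ_gen\<close> and \<open>meet_op_LQ_gen\<close> this determines the generated cover from \<open>X\<close>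
  alone. The unit axioms are instances of the unit law of \<open>X\<close>, so they hold in every larger cover.\<close>

lemma LQ_gen_least:
  assumes X: "circ_cover X" and P: "presents X ax E"
    and R: "basic_cover (carrier X) R" "cov X \<subseteq> R" "meet_op (carrier X) R (pointwise X)"
  shows "cov (LQ_gen X ax E) \<subseteq> R"
  unfolding LQ_gen_def
proof (rule gen_formal_cover_least[OF R(1,3)])
  have ax: "axiom_set (carrier X) ax" "cov X = gen_cov (carrier X) ax" and E: "is_unit X E"
    using P unfolding presents_def by simp_all
  note E_sub = is_unitD(1)[OF E] and is_cov = circ_coverD(1)[OF X]
  have unit: "(a, circ X {b} E) \<in> cov X \<longleftrightarrow> (a, {b}) \<in> cov X" if "b \<in> carrier X" for a b
    using is_unitD(2)[OF E that] eqA_iff_cov[OF is_cov] by blast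
  fix a D assume a: "a \<in> carrier X" and D: "D \<in> ax a \<union> unit_axioms X E a"
  from D consider "D \<in> ax a" | "D = circ X {a} E"
    | b where "b \<in> carrier X" "a \<in> circ X {b} E" "D = {b}"
    unfolding unit_axioms_def by blast
  then have "(a, D) \<in> cov X"
  proof cases
    case 1
    then show ?thesis
      using ax a unfolding axiom_set_def by (auto intro: gen_cov_axiom)
  next
    case 2
    then show ?thesis
      using unit[OF a] basic_cover_refl[OF is_cov, of "{a}" a] a by simp
  next
    case 3
    then have "(a, circ X {b} E) \<in> cov X"
      using circ_coverD(2)[OF X, of "{b}" E] E_sub by (intro basic_cover_refl[OF is_cov]) auto
    then show ?thesis using unit 3 by simp
  qed
  then show "(a, D) \<in> R" using R(2) by blast
qed

lemma LQ_gen_unique: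
  assumes X: "circ_cover X" and P: "presents X ax E" "presents X ax' E'"
  shows "LQ_gen X ax E = LQ_gen X ax' E'"
proof -
  have "cov (LQ_gen X a e) \<subseteq> cov (LQ_gen X a' e')"
    if "presents X a e" "presents X a' e'" for a e a' e'
    using LQ_gen_least[OF X that(1)] is_cover_LQ_gen[of X a' e'] cov_subset_LQ_gen[OF that(2)]
      meet_op_LQ_gen[OF X that(2)] by (simp add: LQ_gen_simps)
  then have "cov (LQ_gen X ax E) = cov (LQ_gen X ax' E')"
    using P by blast
  then show ?thesis
    by (intro cover.equality) (simp_all add: LQ_gen_simps)
qed

lemma LQ_obj_eq:
  assumes "circ_cover X" "presents X ax E"
  shows "LQ_obj X = LQ_gen X ax E"
proof -
  have "\<exists>ax E. presents X ax E \<and> LQ_obj X = LQ_gen X ax E"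
    unfolding LQ_obj_def by (rule someI[of _ "LQ_gen X ax E"]) (use assms in blast)
  then show ?thesis
    using LQ_gen_unique[OF assms(1) _ assms(2)] by metis
qed

lemma LQ_obj_props:
  assumes "X \<in> Obj BCov"
  shows "carrier (LQ_obj X) = carrier X" "circ (LQ_obj X) = pointwise X"
    and "is_cover (LQ_obj X)" "LQ_obj X \<in> Obj FCov"
    and "cov X \<subseteq> cov (LQ_obj X)" "meet_op (carrier X) (cov (LQ_obj X)) (pointwise X)"
proof -
  have X: "circ_cover X" using assms unfolding Obj_BCov by simp
  obtain ax E where P: "presents X ax E" using presents_exists[OF assms] by blast
  note eq = LQ_obj_eq[OF X P]
  show "carrier (LQ_obj X) = carrier X" "circ (LQ_obj X) = pointwise X"
    and "is_cover (LQ_obj X)" "LQ_obj X \<in> Obj FCov"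
    and "cov X \<subseteq> cov (LQ_obj X)" "meet_op (carrier X) (cov (LQ_obj X)) (pointwise X)"
    unfolding eq using is_cover_LQ_gen[of X ax E] LQ_gen_in_FCov[OF X P] cov_subset_LQ_gen[OF P]
      meet_op_LQ_gen[OF X P] by (simp_all add: LQ_gen_simps)
qed

lemma LQ_obj_least:
  assumes "X \<in> Obj BCov" "basic_cover (carrier X) R" "cov X \<subseteq> R"
    "meet_op (carrier X) R (pointwise X)"
  shows "cov (LQ_obj X) \<subseteq> R"
proof -
  have X: "circ_cover X" using assms(1) unfolding Obj_BCov by simp
  obtain ax E where P: "presents X ax E" using presents_exists[OF assms(1)] by blast
  show ?thesis
    unfolding LQ_obj_eq[OF X P] by (rule LQ_gen_least[OF X P assms(2-4)])
qed

lemma eqA_LQ_obj: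
  assumes X: "X \<in> Obj BCov" and "U \<subseteq> carrier X" "V \<subseteq> carrier X" "eqA X U V"
  shows "eqA (LQ_obj X) U V"
proof (rule eqA_larger_cover)
  show "is_cover X" using X circ_coverD(1) unfolding Obj_BCov by blast
qed (use assms LQ_obj_props[OF X] in auto)

text \<open>Where the operation is a meet, \<open>a \<lhd> a \<circ> E\<close> forces \<open>a \<lhd> E\<close>: a unit covers everything.\<close>

lemma unit_eqA_carrier_LQ_obj:
  assumes X: "X \<in> Obj BCov" and E: "is_unit X E"
  shows "eqA (LQ_obj X) E (carrier X)"
proof -
  have circX: "circ_cover X" using X unfolding Obj_BCov by simp
  note P = LQ_obj_props[OF X] and E_sub = is_unitD(1)[OF E]
  have "(a, E) \<in> cov (LQ_obj X)" if a: "a \<in> carrier X" for a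
  proof -
    have "eqA X {a} (circ X {a} E)" by (rule is_unitD(2)[OF E a])
    also have "eqA X \<dots> (pointwise X {a} E)"
      using a by (intro circ_eqA_pointwise[OF circX _ E_sub]) auto
    finally have "eqA (LQ_obj X) {a} (pointwise X {a} E)"
      using a E_sub meet_opD(1)[OF P(6)] by (intro eqA_LQ_obj[OF X]) auto
    then have "(a, pointwise X {a} E) \<in> cov (LQ_obj X)"
      using eqA_iff_cov[OF P(3)] basic_cover_refl[OF P(3), of "{a}" a] a P(1) by auto
    then show ?thesis
      using meet_opD(2)[OF P(6), of "{a}" E a] a E_sub by simp
  qed
  then show ?thesis
    using P(1,3) E_sub basic_cover_refl[OF P(3), of "carrier X"]
    by (subst eqA_iff_covers) (auto simp: covers_def)
qed


subsection \<open>Formal covers among covers with an operation\<close>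

lemma FCov_circ:
  assumes "X \<in> Obj FCov"
  shows "\<exists>\<delta>. circ X = lift_op (carrier X) \<delta>"
proof -
  obtain ax \<delta> where eq: "X = gen_formal_cover (carrier X) ax \<delta>"
    using assms unfolding Obj_FCov by blast
  have "circ X = lift_op (carrier X) \<delta>"
    by (subst eq) simp
  then show ?thesis by blast
qed

lemma FCov_pointwise:
  assumes "X \<in> Obj FCov"
  shows "pointwise X = circ X"
  using FCov_circ[OF assms] lift_op_lift_op by metis

lemma FCov_meet_op:
  assumes "X \<in> Obj FCov"
  shows "is_cover X" "meet_op (carrier X) (cov X) (circ X)"
  using assms formal_cover_meet_op unfolding Obj_FCov by blast+

lemma FCov_unit:
  assumes "X \<in> Obj FCov"
  shows "is_unit X (carrier X)"
  unfolding is_unit_def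
proof (intro conjI ballI subset_refl)
  fix a assume a: "a \<in> carrier X"
  note X = FCov_meet_op[OF assms]
  have "(b, carrier X) \<in> cov X" if "b \<in> carrier X" for b
    using that by (rule basic_cover_refl[OF X(1) subset_refl])
  then have "(b, {a}) \<in> cov X \<longleftrightarrow> (b, circ X {a} (carrier X)) \<in> cov X" for b
    using meet_opD(2)[OF X(2), of "{a}" "carrier X" b] a basic_cover_carrier(1)[OF X(1)] by auto
  then show "eqA X {a} (circ X {a} (carrier X))"
    by (simp add: eqA_iff_cov[OF X(1)])
qed

lemma FCov_subset_BCov:
  assumes F: "X \<in> Obj FCov"
  shows "X \<in> Obj BCov"
proof -
  note X = FCov_meet_op[OF F]
  note m = meet_opD[OF X(2)]
  obtain \<delta> where circ: "circ X = lift_op (carrier X) \<delta>" using FCov_circ[OF F] by blast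
  have dist: "(\<Union>U\<in>\<U>. circ X U V) = circ X (\<Union>\<U>) V"
    if "\<U> \<subseteq> Pow (carrier X)" "V \<subseteq> carrier X" for \<U> V
    unfolding circ lift_op_def using that by auto
  have "op_cover X"
    using F unfolding Obj_FCov formal_cover_def convergent_cover_def by simp
  then have "circ_cover X"
    unfolding circ_cover_def
  proof (intro conjI allI impI exI)
    show "is_unit X (carrier X)" by (rule FCov_unit[OF F])
  qed (simp_all add: eqA_iff_cov[OF X(1)] dist m conj_ac)
  moreover obtain ax \<delta> where ax: "axiom_set (carrier X) ax"
    "\<forall>a\<in>carrier X. \<forall>b\<in>carrier X. \<delta> a b \<subseteq> carrier X" "X = gen_formal_cover (carrier X) ax \<delta>"
    using F unfolding Obj_FCov by blast
  moreover have "cov X = gen_cov (carrier X) (ax_J'' (carrier X) (lift_op (carrier X) \<delta>) ax)"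
    by (subst ax(3)) simp
  moreover have "axiom_set (carrier X) (ax_J'' (carrier X) (lift_op (carrier X) \<delta>) ax)"
    by (rule axiom_set_ax_J(3)) (use ax in auto)
  ultimately show ?thesis
    unfolding Obj_BCov by blast
qed

text \<open>The cover of a formal cover is among those over which the minimum is taken.\<close>

lemma LQ_obj_FCov:
  assumes F: "X \<in> Obj FCov"
  shows "LQ_obj X = X"
proof -
  note B = FCov_subset_BCov[OF F] and X = FCov_meet_op[OF F]
  have "cov (LQ_obj X) \<subseteq> cov X"
    using X FCov_pointwise[OF F] by (intro LQ_obj_least[OF B]) auto
  then show ?thesis
    using LQ_obj_props[OF B] FCov_pointwise[OF F] by (intro cover.equality) auto
qed


subsection \<open>Maps\<close>

lemma circ_mapD:
  assumes "circ_map X Y r"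
  shows "basic_map X Y r"
    and "\<And>U V. U \<subseteq> carrier Y \<Longrightarrow> V \<subseteq> carrier Y \<Longrightarrow>
           eqA X (preim r (circ Y U V)) (circ X (preim r U) (preim r V))"
    and "\<And>E F. is_unit X E \<Longrightarrow> is_unit Y F \<Longrightarrow> eqA X (preim r F) E"
  using assms unfolding circ_map_def by simp_all

text \<open>\<open>r\<close> preserves the operation modulo the cover of \<open>X\<close>, hence modulo the larger cover of its image.
  So the operation of \<open>Y\<close> is a meet for the inverse image of that cover, and minimality applies.\<close>

lemma formal_map_LQ_obj:
  assumes X: "X \<in> Obj BCov" and Y: "Y \<in> Obj BCov" and r: "circ_map X Y r"
  shows "formal_map (LQ_obj X) (LQ_obj Y) r"
proof -
  have circX: "circ_cover X" and circY: "circ_cover Y"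
    using X Y unfolding Obj_BCov by simp_all
  note is_cov = circ_coverD(1)[OF circX] circ_coverD(1)[OF circY]
  note basic = circ_mapD(1)[OF r]
  note r_sub = basic_map_subset[OF basic] and pre = basic_map_preim_subset[OF basic]
  note PX = LQ_obj_props[OF X] and PY = LQ_obj_props[OF Y]
  note closedX = meet_opD(1)[OF PX(6)] and closedY = meet_opD(1)[OF PY(6)]
  have pres: "eqA (LQ_obj X) (preim r (pointwise Y U V)) (pointwise X (preim r U) (preim r V))"
    if UV: "U \<subseteq> carrier Y" "V \<subseteq> carrier Y" for U V
  proof (rule eqA_LQ_obj[OF X pre closedX[OF pre pre]])
    have "eqA X (preim r (pointwise Y U V)) (preim r (circ Y U V))"
      by (rule basic_map_eqA[OF is_cov basic closedY[OF UV] circ_coverD(2)[OF circY UV]])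
        (rule eqA_sym[OF circ_eqA_pointwise[OF circY UV]])
    also have "eqA X \<dots> (circ X (preim r U) (preim r V))"
      by (rule circ_mapD(2)[OF r UV])
    also have "eqA X \<dots> (pointwise X (preim r U) (preim r V))"
      by (rule circ_eqA_pointwise[OF circX pre pre])
    finally show "eqA X (preim r (pointwise Y U V)) (pointwise X (preim r U) (preim r V))" .
  qed
  have "cov Y \<subseteq> pull_cov X (carrier Y) r"
    using basic basic_map_iff_pull_cov[OF is_cov(2)] by blast
  also have "\<dots> \<subseteq> pull_cov (LQ_obj X) (carrier Y) r"
    using PX(5) unfolding pull_cov_def covers_def by blast
  finally have "cov (LQ_obj Y) \<subseteq> pull_cov (LQ_obj X) (carrier Y) r"
    using PX(1,3,6) r_sub closedY pres
    by (intro LQ_obj_least[OF Y] basic_cover_pull_cov meet_op_pull_cov[where m = "pointwise X"]) auto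
  then have "basic_map (LQ_obj X) (LQ_obj Y) r"
    unfolding basic_map_iff_pull_cov[OF PY(3)] using r_sub PX(1) PY(1) by simp
  moreover have "eqA (LQ_obj X) (preim r (carrier Y)) (carrier X)"
  proof -
    obtain E F where E: "is_unit X E" and F: "is_unit Y F"
      using circ_coverD(5)[OF circX] circ_coverD(5)[OF circY] by blast
    have "eqA (LQ_obj X) (preim r (carrier Y)) (preim r F)"
      by (rule basic_map_eqA[OF PX(3) PY(3) \<open>basic_map (LQ_obj X) (LQ_obj Y) r\<close>])
        (use eqA_sym[OF unit_eqA_carrier_LQ_obj[OF Y F]] is_unitD(1)[OF F] PY(1) in auto)
    also have "eqA (LQ_obj X) \<dots> E"
      by (rule eqA_LQ_obj[OF X pre is_unitD(1)[OF E] circ_mapD(3)[OF r E F]])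
    also have "eqA (LQ_obj X) \<dots> (carrier X)"
      by (rule unit_eqA_carrier_LQ_obj[OF X E])
    finally show ?thesis .
  qed
  ultimately show ?thesis
    unfolding formal_map_def PX(1,2) PY(1,2) using pres by simp
qed

text \<open>A formal cover map preserves products of elements. The operation of a formal cover distributes
  over unions exactly, so products of subsets are preserved in pointwise form, and in \<open>Y\<close> the pointwise
  form agrees with the operation modulo the cover of \<open>Y\<close>.\<close>

lemma circ_map_of_formal_map:
  assumes X: "X \<in> Obj FCov" and Y: "Y \<in> Obj BCov" and r: "formal_map X (LQ_obj Y) r"
  shows "circ_map X Y r"
proof -
  have circX: "circ_cover X" and circY: "circ_cover Y"
    using FCov_subset_BCov[OF X] Y unfolding Obj_BCov by simp_all
  note is_cov = circ_coverD(1)[OF circX] circ_coverD(1)[OF circY]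
  note PY = LQ_obj_props[OF Y]
  have basic: "basic_map X (LQ_obj Y) r"
    and atoms: "\<And>a b. a \<in> carrier Y \<Longrightarrow> b \<in> carrier Y \<Longrightarrow>
      eqA X (preim r (pointwise Y {a} {b})) (circ X (preim r {a}) (preim r {b}))"
    and top: "eqA X (preim r (carrier Y)) (carrier X)"
    using r unfolding formal_map_def PY(1,2) by simp_all
  note pre = basic_map_preim_subset[OF basic]
  have basic': "basic_map X Y r"
    using basic PY(1,5) unfolding basic_map_def by blast
  obtain \<delta> where circ: "circ X = lift_op (carrier X) \<delta>" using FCov_circ[OF X] by blast
  have pres: "eqA X (preim r (circ Y U V)) (circ X (preim r U) (preim r V))"
    if UV: "U \<subseteq> carrier Y" "V \<subseteq> carrier Y" for U V
  proof -
    have "eqA X (preim r (circ Y U V)) (preim r (pointwise Y U V))"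
      by (rule basic_map_eqA[OF is_cov basic' circ_coverD(2)[OF circY UV] meet_opD(1)[OF PY(6) UV]])
        (rule circ_eqA_pointwise[OF circY UV])
    also have "preim r (pointwise Y U V) = (\<Union>(a, b)\<in>U \<times> V. preim r (pointwise Y {a} {b}))"
    proof -
      have "x \<in> pointwise Y U V \<longleftrightarrow> x \<in> (\<Union>(a, b)\<in>U \<times> V. pointwise Y {a} {b})" for x
        using UV by (auto simp: lift_op_iff subset_iff lift_op_singletons)
      then have "pointwise Y U V = (\<Union>(a, b)\<in>U \<times> V. pointwise Y {a} {b})"
        by blast
      then show ?thesis by (simp add: preim_UN case_prod_beta)
    qed
    also have "eqA X \<dots> (\<Union>(a, b)\<in>U \<times> V. circ X (preim r {a}) (preim r {b}))"
    proof (rule eqA_UN[OF is_cov(1)])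
      fix p assume "p \<in> U \<times> V"
      then obtain a b where p: "p = (a, b)" "a \<in> carrier Y" "b \<in> carrier Y"
        using UV by auto
      show "(case p of (a, b) \<Rightarrow> preim r (pointwise Y {a} {b})) \<subseteq> carrier X"
        "(case p of (a, b) \<Rightarrow> circ X (preim r {a}) (preim r {b})) \<subseteq> carrier X"
        "eqA X (case p of (a, b) \<Rightarrow> preim r (pointwise Y {a} {b}))
               (case p of (a, b) \<Rightarrow> circ X (preim r {a}) (preim r {b}))"
        using p pre atoms circ_coverD(2)[OF circX] by simp_all
    qed
    also have "(\<Union>(a, b)\<in>U \<times> V. circ X (preim r {a}) (preim r {b})) =
               circ X (preim r U) (preim r V)"
    proof -
      have "(\<Union>(a, b)\<in>U \<times> V. circ X (preim r {a}) (preim r {b})) =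
            (\<Union>(a, b)\<in>U \<times> V. \<Union>x\<in>preim r {a}. \<Union>y\<in>preim r {b}. \<delta> x y)"
        unfolding circ lift_op_def using pre by simp
      also have "\<dots> = (\<Union>x\<in>(\<Union>a\<in>U. preim r {a}). \<Union>y\<in>(\<Union>b\<in>V. preim r {b}). \<delta> x y)"
        by blast
      finally show ?thesis
        unfolding circ lift_op_def preim_singletons using pre by simp
    qed
    finally show ?thesis .
  qed
  have "eqA X (preim r F) E" if E: "is_unit X E" and F: "is_unit Y F" for E F
  proof -
    have "eqA X (preim r F) (preim r (carrier Y))"
      using unit_eqA_carrier_LQ_obj[OF Y F] is_unitD(1)[OF F] PY(1)
      by (intro basic_map_eqA[OF is_cov(1) PY(3) basic]) auto
    also have "eqA X \<dots> (carrier X)" by (rule top)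
    also have "eqA X \<dots> E" by (rule unit_unique[OF circX FCov_unit[OF X] E])
    finally show ?thesis .
  qed
  then show ?thesis
    unfolding circ_map_def using basic' pres by blast
qed

text \<open>The adjunction at the level of representing relations.\<close>

lemma formal_map_LQ_obj_iff:
  assumes "X \<in> Obj FCov" "Y \<in> Obj BCov"
  shows "formal_map X (LQ_obj Y) r \<longleftrightarrow> circ_map X Y r"
  using circ_map_of_formal_map[OF assms] formal_map_LQ_obj[OF FCov_subset_BCov[OF assms(1)] assms(2)]
    LQ_obj_FCov[OF assms(1)] by metis

lemma formal_map_iff_circ_map:
  assumes "X \<in> Obj FCov" "Y \<in> Obj FCov"
  shows "formal_map X Y r \<longleftrightarrow> circ_map X Y r"
  using formal_map_LQ_obj_iff[OF assms(1) FCov_subset_BCov[OF assms(2)]] LQ_obj_FCov[OF assms(2)]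
  by simp

lemma circ_map_Id_on:
  assumes X: "circ_cover X"
  shows "circ_map X X (Id_on (carrier X))"
  unfolding circ_map_def
proof (intro conjI allI impI)
  show "eqA X (preim (Id_on (carrier X)) F) E" if "is_unit X E" "is_unit X F" for E F
    using unit_unique[OF X that(2,1)] is_unitD(1)[OF that(2)] by (simp add: preim_Id_on)
qed (use basic_map_Id_on[OF circ_coverD(1)[OF X]] circ_coverD(2)[OF X] in
    \<open>simp_all add: preim_Id_on eqA_refl\<close>)

lemma circ_map_comp:
  assumes X: "circ_cover X" and Y: "circ_cover Y" and Z: "circ_cover Z"
    and r: "circ_map X Y r" and s: "circ_map Y Z s"
  shows "circ_map X Z (r O s)"
proof -
  note is_cov = circ_coverD(1)[OF X] circ_coverD(1)[OF Y]
  note basic = circ_mapD(1)[OF r] circ_mapD(1)[OF s]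
  note pre = basic_map_preim_subset[OF basic(2)]
  note pull = basic_map_eqA[OF is_cov basic(1)]
  have "eqA X (preim (r O s) (circ Z U V)) (circ X (preim (r O s) U) (preim (r O s) V))"
    if "U \<subseteq> carrier Z" "V \<subseteq> carrier Z" for U V
    unfolding preim_comp
    using pull[OF pre circ_coverD(2)[OF Y pre pre] circ_mapD(2)[OF s that]]
      circ_mapD(2)[OF r pre pre] by (rule eqA_trans)
  moreover have "eqA X (preim (r O s) G) E" if E: "is_unit X E" and G: "is_unit Z G" for E G
  proof -
    obtain F where F: "is_unit Y F" using circ_coverD(5)[OF Y] by blast
    show ?thesis
      unfolding preim_comp
      using pull[OF pre is_unitD(1)[OF F] circ_mapD(3)[OF s F G]] circ_mapD(3)[OF r E F]
      by (rule eqA_trans)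
  qed
  ultimately show ?thesis
    unfolding circ_map_def using basic_map_comp[OF basic] by blast
qed


section \<open>Categories of covers\<close>

definition same_map :: "'a cover \<Rightarrow> 'a cover \<Rightarrow> ('a \<times> 'a) set \<Rightarrow> ('a \<times> 'a) set \<Rightarrow> bool" where
  "same_map X Y r s \<longleftrightarrow> (\<forall>b\<in>carrier Y. eqA X (preim r {b}) (preim s {b}))"

lemma mem_map_class: "s \<in> map_class M X Y r \<longleftrightarrow> M X Y r \<and> M X Y s \<and> same_map X Y r s"
  unfolding map_class_def map_eq_def same_map_def by auto

lemma same_map_equiv:
  "same_map X Y r r" "same_map X Y r s \<Longrightarrow> same_map X Y s r"
  "same_map X Y r s \<Longrightarrow> same_map X Y s t \<Longrightarrow> same_map X Y r t"
  unfolding same_map_def eqA_def by auto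

lemma map_class_eq_iff:
  assumes "M X Y r" "M X Y s"
  shows "map_class M X Y r = map_class M X Y s \<longleftrightarrow> same_map X Y r s"
proof
  assume "map_class M X Y r = map_class M X Y s"
  then have "s \<in> map_class M X Y r"
    using assms(2) same_map_equiv(1) by (simp add: mem_map_class)
  then show "same_map X Y r s" by (simp add: mem_map_class)
next
  assume "same_map X Y r s"
  then show "map_class M X Y r = map_class M X Y s"
  proof -
    have "same_map X Y r t \<longleftrightarrow> same_map X Y s t" for t
      using \<open>same_map X Y r s\<close> by (simp add: same_map_def eqA_def)
    then have "t \<in> map_class M X Y r \<longleftrightarrow> t \<in> map_class M X Y s" for t
      unfolding mem_map_class using assms by blast
    then show ?thesis by (rule set_eqI)
  qed
qed

text \<open>The unions over representatives in the definitions of composition and of the functors are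
  evaluated at one representative, when the result does not depend on its choice.\<close>

lemma UN_map_class:
  assumes "M X Y r" and "\<And>s. M X Y s \<Longrightarrow> same_map X Y r s \<Longrightarrow> h s = h r"
  shows "(\<Union>s\<in>map_class M X Y r. h s) = h r"
proof -
  have r: "r \<in> map_class M X Y r"
    using assms(1) same_map_equiv(1) by (simp add: mem_map_class)
  have "(\<Union>s\<in>map_class M X Y r. h s) = (\<Union>s\<in>map_class M X Y r. h r)"
    by (intro SUP_cong refl assms(2)) (simp_all add: mem_map_class)
  also have "\<dots> = h r"
    using r by (simp add: UN_constant) blast
  finally show ?thesis .
qed

lemma Obj_cover_cat: "Obj (cover_cat Ob M) = Ob"
  unfolding cover_cat_def by simp

lemma Idt_cover_cat: "Idt (cover_cat Ob M) X = map_class M X X (Id_on (carrier X))"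
  unfolding cover_cat_def by simp

lemma Hom_cover_cat: "f \<in> Hom (cover_cat Ob M) X Y \<longleftrightarrow> (\<exists>r. M X Y r \<and> f = map_class M X Y r)"
  unfolding cover_cat_def quotient_def map_class_def by auto

lemma same_map_comp:
  assumes X: "is_cover X" and Y: "is_cover Y"
    and r: "basic_map X Y r" and s: "basic_map Y Z s" "basic_map Y Z s'"
    and same: "same_map X Y r r'" "same_map Y Z s s'"
    and r': "basic_map X Y r'"
  shows "same_map X Z (r O s) (r' O s')"
  unfolding same_map_def preim_comp
proof
  fix c assume "c \<in> carrier Z"
  then have "eqA X (preim r (preim s {c})) (preim r (preim s' {c}))"
    using same(2) s unfolding same_map_def
    by (intro basic_map_eqA[OF X Y r] basic_map_preim_subset) auto
  also have "preim r (preim s' {c}) = (\<Union>b\<in>preim s' {c}. preim r {b})"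
    by (simp add: preim_singletons)
  also have "eqA X \<dots> (\<Union>b\<in>preim s' {c}. preim r' {b})"
    using same(1) basic_map_preim_subset[OF s(2), of "{c}"] unfolding same_map_def
    by (intro eqA_UN[OF X] basic_map_preim_subset[OF r] basic_map_preim_subset[OF r']) auto
  also have "\<dots> = preim r' (preim s' {c})"
    by (simp add: preim_singletons)
  finally show "eqA X (preim r (preim s {c})) (preim r' (preim s' {c}))" .
qed

text \<open>The conditions on a class of maps are required between objects only: formal cover maps compose
  because between objects of \<open>FCov\<close> they are \<open>\<circ>\<close>-basic cover maps.\<close>

locale cover_maps =
  fixes Ob :: "'a cover set" and M :: "'a mor_pred"
  assumes cover: "X \<in> Ob \<Longrightarrow> is_cover X"
    and basic: "X \<in> Ob \<Longrightarrow> Y \<in> Ob \<Longrightarrow> M X Y r \<Longrightarrow> basic_map X Y r"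
    and ident: "X \<in> Ob \<Longrightarrow> M X X (Id_on (carrier X))"
    and comp: "X \<in> Ob \<Longrightarrow> Y \<in> Ob \<Longrightarrow> Z \<in> Ob \<Longrightarrow> M X Y r \<Longrightarrow> M Y Z s \<Longrightarrow> M X Z (r O s)"
begin

lemma Cmp_map_class:
  assumes Ob: "X \<in> Ob" "Y \<in> Ob" "Z \<in> Ob" and r: "M X Y r" and s: "M Y Z s"
  shows "Cmp (cover_cat Ob M) X Y Z (map_class M Y Z s) (map_class M X Y r) = map_class M X Z (r O s)"
proof -
  have eq: "map_class M X Z (r' O s') = map_class M X Z (r O s)"
    if "M X Y r'" "same_map X Y r r'" "M Y Z s'" "same_map Y Z s s'" for r' s'
  proof -
    have "same_map X Z (r' O s') (r O s)"
      using that r s Ob by (intro same_map_comp[of X Y] cover basic same_map_equiv(2)[of _ _ r]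
          same_map_equiv(2)[of _ _ s]) auto
    moreover have "M X Z (r' O s')" "M X Z (r O s)"
      using comp[OF Ob] that r s by blast+
    ultimately show ?thesis by (simp add: map_class_eq_iff)
  qed
  have "(\<Union>s'\<in>map_class M Y Z s. map_class M X Z (r' O s')) = map_class M X Z (r O s)"
    if r': "M X Y r'" "same_map X Y r r'" for r'
  proof -
    have "map_class M X Z (r' O s') = map_class M X Z (r' O s)"
      if "M Y Z s'" "same_map Y Z s s'" for s'
      using eq[OF r' that] eq[OF r' s same_map_equiv(1)] by simp
    then show ?thesis
      using UN_map_class[of M Y Z s "\<lambda>s'. map_class M X Z (r' O s')"] s
        eq[OF r' s same_map_equiv(1)] by simp
  qed
  then have "(\<Union>r'\<in>map_class M X Y r. \<Union>s'\<in>map_class M Y Z s. map_class M X Z (r' O s')) =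
        map_class M X Z (r O s)"
    using UN_map_class[of M X Y r "\<lambda>r'. \<Union>s'\<in>map_class M Y Z s. map_class M X Z (r' O s')"] r
      same_map_equiv(1)[of X Y r] by simp
  then show ?thesis
    unfolding cover_cat_def by simp
qed

lemma category_cover_cat: "category (cover_cat Ob M)"
proof -
  have Id: "Id_on (carrier X) O r = r" "r O Id_on (carrier Y) = r"
    if "X \<in> Ob" "Y \<in> Ob" "M X Y r" for X Y r
    using basic_map_subset[OF basic[OF that]] by auto
  show ?thesis
    unfolding category_def Obj_cover_cat Idt_cover_cat
  proof (intro conjI ballI)
    fix X assume "X \<in> Ob"
    then show "map_class M X X (Id_on (carrier X)) \<in> Hom (cover_cat Ob M) X X"
      using ident unfolding Hom_cover_cat by blast
  next
    fix X Y Z f g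
    assume Ob: "X \<in> Ob" "Y \<in> Ob" "Z \<in> Ob"
      and "f \<in> Hom (cover_cat Ob M) X Y" "g \<in> Hom (cover_cat Ob M) Y Z"
    then show "Cmp (cover_cat Ob M) X Y Z g f \<in> Hom (cover_cat Ob M) X Z"
      using Cmp_map_class[OF Ob] comp[OF Ob] unfolding Hom_cover_cat by metis
  next
    fix X Y f assume Ob: "X \<in> Ob" "Y \<in> Ob" and "f \<in> Hom (cover_cat Ob M) X Y"
    then obtain r where r: "M X Y r" "f = map_class M X Y r"
      unfolding Hom_cover_cat by blast
    show "Cmp (cover_cat Ob M) X X Y f (map_class M X X (Id_on (carrier X))) = f"
      "Cmp (cover_cat Ob M) X Y Y (map_class M Y Y (Id_on (carrier Y))) f = f"
      unfolding r(2) using Ob r(1) ident Id by (simp_all add: Cmp_map_class)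
  next
    fix W X Y Z f g h
    assume Ob: "W \<in> Ob" "X \<in> Ob" "Y \<in> Ob" "Z \<in> Ob"
      and "f \<in> Hom (cover_cat Ob M) W X" "g \<in> Hom (cover_cat Ob M) X Y"
        "h \<in> Hom (cover_cat Ob M) Y Z"
    then obtain r s t where "M W X r" "f = map_class M W X r" "M X Y s" "g = map_class M X Y s"
      "M Y Z t" "h = map_class M Y Z t"
      unfolding Hom_cover_cat by blast
    then show "Cmp (cover_cat Ob M) W Y Z h (Cmp (cover_cat Ob M) W X Y g f) =
          Cmp (cover_cat Ob M) W X Z (Cmp (cover_cat Ob M) X Y Z h g) f"
      using Ob comp[of W X Y r s] comp[of X Y Z s t] by (simp add: Cmp_map_class O_assoc)
  qed
qed

end

lemma BCov_eq: "BCov = cover_cat (Obj BCov) circ_map"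
  unfolding BCov_def Obj_cover_cat ..

lemma FCov_eq: "FCov = cover_cat (Obj FCov) formal_map"
  unfolding FCov_def Obj_cover_cat ..

interpretation BCov: cover_maps "Obj BCov" circ_map
  rewrites "cover_cat (Obj BCov) circ_map = BCov"
proof -
  show "cover_maps (Obj BCov) circ_map"
    by unfold_locales (auto simp: Obj_BCov intro: circ_coverD(1) circ_mapD(1) circ_map_Id_on circ_map_comp)
qed (rule BCov_eq[symmetric])

interpretation FCov: cover_maps "Obj FCov" formal_map
  rewrites "cover_cat (Obj FCov) formal_map = FCov"
proof -
  show "cover_maps (Obj FCov) formal_map"
    by unfold_locales
      (auto simp: formal_map_iff_circ_map
        intro: BCov.cover BCov.basic BCov.ident BCov.comp FCov_subset_BCov)
qed (rule FCov_eq[symmetric])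

lemma Hom_BCov: "f \<in> Hom BCov X Y \<longleftrightarrow> (\<exists>r. circ_map X Y r \<and> f = map_class circ_map X Y r)"
  by (subst BCov_eq) (rule Hom_cover_cat)

lemma Hom_FCov: "f \<in> Hom FCov X Y \<longleftrightarrow> (\<exists>r. formal_map X Y r \<and> f = map_class formal_map X Y r)"
  by (subst FCov_eq) (rule Hom_cover_cat)

lemma Idt_BCov: "Idt BCov X = map_class circ_map X X (Id_on (carrier X))"
  by (subst BCov_eq) (rule Idt_cover_cat)

lemma Idt_FCov: "Idt FCov X = map_class formal_map X X (Id_on (carrier X))"
  by (subst FCov_eq) (rule Idt_cover_cat)


section \<open>The adjunction\<close>

lemma map_class_formal_eq_circ:
  assumes "X \<in> Obj FCov" "Y \<in> Obj FCov"
  shows "map_class formal_map X Y r = map_class circ_map X Y r"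
  using formal_map_iff_circ_map[OF assms] by (simp add: set_eq_iff mem_map_class)

lemma Forget_map_class:
  assumes "X \<in> Obj FCov" "Y \<in> Obj FCov" "formal_map X Y r"
  shows "on_mor Forget X Y (map_class formal_map X Y r) = map_class circ_map X Y r"
proof -
  have r: "circ_map X Y r"
    using assms formal_map_iff_circ_map by blast
  have "(\<Union>s\<in>map_class circ_map X Y r. map_class circ_map X Y s) = map_class circ_map X Y r"
  proof (rule UN_map_class[where M = circ_map, OF r])
    fix s assume "circ_map X Y s" "same_map X Y r s"
    then show "map_class circ_map X Y s = map_class circ_map X Y r"
      using r same_map_equiv(2)[of X Y r s] by (simp add: map_class_eq_iff)
  qed
  then show ?thesis
    unfolding Forget_def map_class_formal_eq_circ[OF assms(1,2)] by simp
qed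

lemma LQ_map_class:
  assumes X: "X \<in> Obj BCov" and Y: "Y \<in> Obj BCov" and r: "circ_map X Y r"
  shows "on_mor LQ X Y (map_class circ_map X Y r) = map_class formal_map (LQ_obj X) (LQ_obj Y) r"
proof -
  have "map_class formal_map (LQ_obj X) (LQ_obj Y) s = map_class formal_map (LQ_obj X) (LQ_obj Y) r"
    if s: "circ_map X Y s" "same_map X Y r s" for s
  proof -
    have "same_map (LQ_obj X) (LQ_obj Y) s r"
      unfolding same_map_def LQ_obj_props(1)[OF Y]
    proof
      fix b assume "b \<in> carrier Y"
      then have "eqA X (preim s {b}) (preim r {b})"
        using s(2) unfolding same_map_def by (simp add: eqA_sym)
      then show "eqA (LQ_obj X) (preim s {b}) (preim r {b})"
        by (intro eqA_LQ_obj[OF X] basic_map_preim_subset[OF circ_mapD(1)[OF r]]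
            basic_map_preim_subset[OF circ_mapD(1)[OF s(1)]])
    qed
    then show ?thesis
      using formal_map_LQ_obj[OF X Y] r s by (simp add: map_class_eq_iff)
  qed
  then have "(\<Union>s\<in>map_class circ_map X Y r. map_class formal_map (LQ_obj X) (LQ_obj Y) s) =
      map_class formal_map (LQ_obj X) (LQ_obj Y) r"
    by (intro UN_map_class[where M = circ_map] r)
  then show ?thesis
    unfolding LQ_def by simp
qed

lemma on_obj_simps: "on_obj Forget X = X" "on_obj LQ X = LQ_obj X"
  unfolding Forget_def LQ_def by simp_all

lemma is_functor_Forget: "is_functor FCov BCov Forget"
  unfolding is_functor_def on_obj_simps
proof (intro conjI ballI)
  fix X Y :: "'a cover" and f assume Ob: "X \<in> Obj FCov" "Y \<in> Obj FCov" and "f \<in> Hom FCov X Y"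
  then show "on_mor Forget X Y f \<in> Hom BCov X Y"
    unfolding Hom_FCov Hom_BCov using Forget_map_class[OF Ob] formal_map_iff_circ_map[OF Ob] by auto
next
  fix X :: "'a cover" assume X: "X \<in> Obj FCov"
  then show "on_mor Forget X X (Idt FCov X) = Idt BCov X"
    unfolding Idt_FCov Idt_BCov by (intro Forget_map_class FCov.ident)
next
  fix X Y Z :: "'a cover" and f g
  assume Ob: "X \<in> Obj FCov" "Y \<in> Obj FCov" "Z \<in> Obj FCov"
    and "f \<in> Hom FCov X Y" "g \<in> Hom FCov Y Z"
  then obtain r s where r: "formal_map X Y r" and f: "f = map_class formal_map X Y r"
    and s: "formal_map Y Z s" and g: "g = map_class formal_map Y Z s"
    unfolding Hom_FCov by blast
  have "circ_map X Y r" "circ_map Y Z s"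
    using r s Ob formal_map_iff_circ_map by blast+
  then show "on_mor Forget X Z (Cmp FCov X Y Z g f) =
      Cmp BCov X Y Z (on_mor Forget Y Z g) (on_mor Forget X Y f)"
    unfolding f g using Ob r s FCov.comp[OF Ob r s]
    by (simp add: FCov.Cmp_map_class BCov.Cmp_map_class FCov_subset_BCov Forget_map_class)
qed (use FCov.category_cover_cat BCov.category_cover_cat FCov_subset_BCov in auto)

lemma is_functor_LQ: "is_functor BCov FCov LQ"
  unfolding is_functor_def on_obj_simps
proof (intro conjI ballI)
  fix X Y :: "'a cover" and f assume Ob: "X \<in> Obj BCov" "Y \<in> Obj BCov" and "f \<in> Hom BCov X Y"
  then show "on_mor LQ X Y f \<in> Hom FCov (LQ_obj X) (LQ_obj Y)"
    unfolding Hom_FCov Hom_BCov using LQ_map_class[OF Ob] formal_map_LQ_obj[OF Ob] by auto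
next
  fix X :: "'a cover" assume X: "X \<in> Obj BCov"
  then show "on_mor LQ X X (Idt BCov X) = Idt FCov (LQ_obj X)"
    unfolding Idt_FCov Idt_BCov LQ_obj_props(1)[OF X] by (intro LQ_map_class BCov.ident)
next
  fix X Y Z :: "'a cover" and f g
  assume Ob: "X \<in> Obj BCov" "Y \<in> Obj BCov" "Z \<in> Obj BCov"
    and "f \<in> Hom BCov X Y" "g \<in> Hom BCov Y Z"
  then obtain r s where r: "circ_map X Y r" and f: "f = map_class circ_map X Y r"
    and s: "circ_map Y Z s" and g: "g = map_class circ_map Y Z s"
    unfolding Hom_BCov by blast
  show "on_mor LQ X Z (Cmp BCov X Y Z g f) =
      Cmp FCov (LQ_obj X) (LQ_obj Y) (LQ_obj Z) (on_mor LQ Y Z g) (on_mor LQ X Y f)"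
    unfolding f g using Ob r s BCov.comp[OF Ob r s] formal_map_LQ_obj[OF Ob(1,2) r]
      formal_map_LQ_obj[OF Ob(2,3) s]
    by (simp add: FCov.Cmp_map_class BCov.Cmp_map_class LQ_obj_props(4) LQ_map_class)
qed (use FCov.category_cover_cat BCov.category_cover_cat LQ_obj_props(4) in auto)

text \<open>On representatives the map is the identity, by \<open>formal_map_LQ_obj_iff\<close>. Equality of classes is
  the same on both sides, as \<open>X\<close> is fixed by \<open>L \<cdot> Q\<close> and \<open>Y\<close> keeps its carrier.\<close>

lemma bij_betw_LQ:
  assumes X: "X \<in> Obj FCov" and Y: "Y \<in> Obj BCov"
  shows "bij_betw (on_mor LQ X Y) (Hom BCov X Y) (Hom FCov X (LQ_obj Y))"
proof -
  note XB = FCov_subset_BCov[OF X] and iff = formal_map_LQ_obj_iff[OF X Y]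
  have eq: "on_mor LQ X Y (map_class circ_map X Y r) = map_class formal_map X (LQ_obj Y) r"
    if "circ_map X Y r" for r
    using LQ_map_class[OF XB Y that] LQ_obj_FCov[OF X] by simp
  have same: "same_map X (LQ_obj Y) r s \<longleftrightarrow> same_map X Y r s" for r s
    unfolding same_map_def LQ_obj_props(1)[OF Y] ..
  show ?thesis
    unfolding bij_betw_def
  proof
    show "inj_on (on_mor LQ X Y) (Hom BCov X Y)"
    proof (rule inj_onI)
      fix f g assume "f \<in> Hom BCov X Y" "g \<in> Hom BCov X Y"
        and fg: "on_mor LQ X Y f = on_mor LQ X Y g"
      then obtain r s where r: "circ_map X Y r" "f = map_class circ_map X Y r"
        and s: "circ_map X Y s" "g = map_class circ_map X Y s"
        unfolding Hom_BCov by blast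
      have "same_map X (LQ_obj Y) r s"
        using fg r s iff by (simp add: eq map_class_eq_iff)
      then show "f = g"
        using r s same by (simp add: map_class_eq_iff)
    qed
    show "on_mor LQ X Y ` Hom BCov X Y = Hom FCov X (LQ_obj Y)"
    proof (intro equalityI subsetI)
      fix f assume "f \<in> on_mor LQ X Y ` Hom BCov X Y"
      then obtain g where g: "g \<in> Hom BCov X Y" "f = on_mor LQ X Y g" by (rule imageE)
      then obtain r where r: "circ_map X Y r" "g = map_class circ_map X Y r"
        unfolding Hom_BCov by blast
      then have "f = map_class formal_map X (LQ_obj Y) r"
        using g(2) eq by simp
      then show "f \<in> Hom FCov X (LQ_obj Y)"
        unfolding Hom_FCov iff using r(1) by blast
    next
      fix f assume "f \<in> Hom FCov X (LQ_obj Y)"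
      then obtain r where r: "circ_map X Y r" "f = map_class formal_map X (LQ_obj Y) r"
        unfolding Hom_FCov iff by blast
      then have "map_class circ_map X Y r \<in> Hom BCov X Y"
        unfolding Hom_BCov by blast
      then show "f \<in> on_mor LQ X Y ` Hom BCov X Y"
        using eq[OF r(1)] r(2) by (metis image_eqI)
    qed
  qed
qed

lemma category_Cmp:
  assumes "category C" "x \<in> Obj C" "y \<in> Obj C" "z \<in> Obj C" "f \<in> Hom C x y" "g \<in> Hom C y z"
  shows "Cmp C x y z g f \<in> Hom C x z"
  using assms unfolding category_def by simp

lemma is_functor_Hom:
  assumes "is_functor C D F" "x \<in> Obj C" "y \<in> Obj C" "f \<in> Hom C x y"
  shows "on_mor F x y f \<in> Hom D (on_obj F x) (on_obj F y)"
  using assms unfolding is_functor_def by simp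

lemma is_functor_Cmp:
  assumes "is_functor C D F" "x \<in> Obj C" "y \<in> Obj C" "z \<in> Obj C" "f \<in> Hom C x y" "g \<in> Hom C y z"
  shows "on_mor F x z (Cmp C x y z g f) =
    Cmp D (on_obj F x) (on_obj F y) (on_obj F z) (on_mor F y z g) (on_mor F x y f)"
  using assms unfolding is_functor_def by simp

lemma LQ_Forget:
  assumes Ob: "X \<in> Obj FCov" "Y \<in> Obj FCov" and f: "f \<in> Hom FCov X Y"
  shows "on_mor LQ X Y (on_mor Forget X Y f) = f"
proof -
  obtain r where r: "formal_map X Y r" "f = map_class formal_map X Y r"
    using f unfolding Hom_FCov by blast
  have "circ_map X Y r"
    using r formal_map_iff_circ_map[OF Ob] by blast
  then show ?thesis
    using r Ob Forget_map_class LQ_map_class FCov_subset_BCov LQ_obj_FCov by metis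
qed

text \<open>The action of \<open>LQ\<close> on morphisms serves as the bijection. Its naturality is functoriality of
  \<open>LQ\<close>, since \<open>LQ\<close> after \<open>Forget\<close> is the identity.\<close>

lemma adjunction_Forget_LQ: "adjunction FCov BCov Forget LQ"
  unfolding adjunction_def on_obj_simps
proof (intro conjI is_functor_Forget is_functor_LQ exI[of _ "on_mor LQ"] ballI bij_betw_LQ)
  fix x x' y y' :: "'a cover" and h k f
  assume x: "x \<in> Obj FCov" "x' \<in> Obj FCov" and y: "y \<in> Obj BCov" "y' \<in> Obj BCov"
    and h: "h \<in> Hom FCov x' x" and k: "k \<in> Hom BCov y y'" and f: "f \<in> Hom BCov x y"
  note B = x[THEN FCov_subset_BCov]
  note comp = is_functor_Cmp[OF is_functor_LQ, unfolded on_obj_simps]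
  have Fh: "on_mor Forget x' x h \<in> Hom BCov x' x"
    using is_functor_Hom[OF is_functor_Forget x(2,1) h] unfolding on_obj_simps .
  then have "Cmp BCov x' x y f (on_mor Forget x' x h) \<in> Hom BCov x' y"
    using B y f by (intro category_Cmp[OF BCov.category_cover_cat])
  then show "on_mor LQ x' y' (Cmp BCov x' y y' k (Cmp BCov x' x y f (on_mor Forget x' x h))) =
      Cmp FCov x' (LQ_obj y) (LQ_obj y') (on_mor LQ y y' k) (Cmp FCov x' x (LQ_obj y) (on_mor LQ x y f) h)"
    using comp[of x' y y' _ k] comp[of x' x y _ f] B y f k Fh LQ_Forget[OF x(2,1) h]
      LQ_obj_FCov[OF x(1)] LQ_obj_FCov[OF x(2)] by simp
qed

theorem corollary7p7:
  shows "(\<forall>X \<in> Obj (BCov :: ('a cover, 'a mor) cat).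
            \<forall>ax E. presents X ax E \<longrightarrow> on_obj LQ X = LQ_gen X ax E)
       \<and> (\<forall>X \<in> Obj (BCov :: ('a cover, 'a mor) cat). \<forall>Y \<in> Obj BCov. \<forall>r. circ_map X Y r \<longrightarrow>
            formal_map (on_obj LQ X) (on_obj LQ Y) r \<and>
            on_mor LQ X Y (map_class circ_map X Y r)
              = map_class formal_map (on_obj LQ X) (on_obj LQ Y) r)
       \<and> adjunction (FCov :: ('a cover, 'a mor) cat) (BCov :: ('a cover, 'a mor) cat) Forget LQ
       \<and> on_obj LQ ` Obj (BCov :: ('a cover, 'a mor) cat) = Obj FCov"
proof (intro conjI)
  show "\<forall>X \<in> Obj (BCov :: ('a cover, 'a mor) cat).
      \<forall>ax E. presents X ax E \<longrightarrow> on_obj LQ X = LQ_gen X ax E"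
    unfolding on_obj_simps
  proof (intro ballI allI impI)
    fix X :: "'a cover" and ax E
    assume "X \<in> Obj BCov" "presents X ax E"
    then show "LQ_obj X = LQ_gen X ax E"
      using LQ_obj_eq unfolding Obj_BCov by blast
  qed
  show "\<forall>X \<in> Obj (BCov :: ('a cover, 'a mor) cat). \<forall>Y \<in> Obj BCov. \<forall>r. circ_map X Y r \<longrightarrow>
      formal_map (on_obj LQ X) (on_obj LQ Y) r \<and>
      on_mor LQ X Y (map_class circ_map X Y r)
        = map_class formal_map (on_obj LQ X) (on_obj LQ Y) r"
    unfolding on_obj_simps using formal_map_LQ_obj LQ_map_class by blast
  show "adjunction (FCov :: ('a cover, 'a mor) cat) BCov Forget LQ"
    by (rule adjunction_Forget_LQ)
  show "on_obj LQ ` Obj (BCov :: ('a cover, 'a mor) cat) = Obj FCov"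
  proof
    show "on_obj LQ ` Obj (BCov :: ('a cover, 'a mor) cat) \<subseteq> Obj FCov"
      unfolding on_obj_simps using LQ_obj_props(4) by blast
    show "Obj (FCov :: ('a cover, 'a mor) cat) \<subseteq> on_obj LQ ` Obj BCov"
    proof
      fix X :: "'a cover" assume X: "X \<in> Obj FCov"
      show "X \<in> on_obj LQ ` Obj BCov"
        by (rule image_eqI[OF _ FCov_subset_BCov[OF X]]) (simp add: on_obj_simps LQ_obj_FCov[OF X])
    qed
  qed
qed

end
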